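(* Let $n\ge 2$, let $K=\mathbb{Z}[t_1^{\pm1},\dots,t_n^{\pm1}]$, let $M$ be the free left $K$-module with basis $e_1,\dots,e_n$, and let $X$ be the additive group of $M$. For $j=1,\dots,n-1$ let $R_j\in \mathrm{Aut}(X)$ be the automorphism of the abelian group $X$ defined by $$R_j\Big(\sum_{k=1}^n\alpha_ke_k\Big)=\sum_{k=1}^n R_j(\alpha_k)R_j(e_k),\qquad \alpha_k\in K,$$ where $R_j(e_j)=(1-t_{j+1})e_j+t_je_{j+1}$, $R_j(e_{j+1})=e_j$, $R_j(e_k)=e_k$ for $k\ne j,j+1$, and $R_j(\alpha)$ for $\alpha\in K$ is the image of $\alpha$ under the ring automorphism of $K$ that swaps $t_j$ and $t_{j+1}$ and fixes the other $t_k$. Then the map $\varphi_{2B}:\{\sigma_1,\dots,\sigma_{n-1}\}\to \mathrm{Aut}(X)$, $\sigma_j\mapsto R_j$, induces a representation of the braid group $B_n$. The restriction of $\varphi_{2B}$ to the pure braid group $P_n$ is a linear representation $\varphi_{2B}:P_n\to \mathrm{GL}_n(K)$ (i.e. its values are $K$-linear automorphisms of $M$), and it coincides with the Gassner representation $\varphi_G$.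
   Context: Composition: maps act on the right, $fg(x)=g(f(x))$; this is also the product in all automorphism groups. A $K$-linear automorphism $f$ of $M$ is identified with the matrix $(m_{r,s})$ with $f(e_r)=\sum_s m_{r,s}e_s$. $B_n$ has generators $\sigma_1,\dots,\sigma_{n-1}$ and relations $\sigma_i\sigma_{i+1}\sigma_i=\sigma_{i+1}\sigma_i\sigma_{i+1}$ ($1\le i\le n-2$), $\sigma_i\sigma_j=\sigma_j\sigma_i$ ($|i-j|\ge2$). The pure braid group $P_n$ is the kernel of the homomorphism $B_n\to\Sigma_n$, $\sigma_i\mapsto(i,\,i+1)$; it is generated by $a_{i,j}=\sigma_{j-1}\sigma_{j-2}\cdots\sigma_{i+1}\sigma_i^2\sigma_{i+1}^{-1}\cdots\sigma_{j-2}^{-1}\sigma_{j-1}^{-1}$, $1\le i<j\le n$. Gassner representation: let $F_n$ be the free group on $x_1,\dots,x_n$ and $\varphi_A:B_n\to\mathrm{Aut}(F_n)$ the Artin representation, $\varphi_A(\sigma_i): x_i\mapsto x_ix_{i+1}x_i^{-1}$, $x_{i+1}\mapsto x_i$, other generators fixed. Let $\partial/\partial x_s$ be the Fox derivatives $F_n\to\mathbb{Z}F_n$ and let $^{ab}:\mathbb{Z}F_n\to K$ be the ring homomorphism induced by $x_i\mapsto t_i$. Then $\varphi_G:P_n\to\mathrm{GL}_n(K)$ is the homomorphism with $\varphi_G(a_{i,j})=\Big(\big(\partial\varphi_A(a_{i,j})(x_r)/\partial x_s\big)^{ab}\Big)_{r,s}$. Explicitly, as a map on the basis of $M$: $\varphi_G(a_{i,j})e_k=e_k$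 for $k<i$ or $k>j$; $\varphi_G(a_{i,j})e_i=(1-t_i+t_it_j)e_i+t_i(1-t_i)e_j$; $\varphi_G(a_{i,j})e_k=(1-t_k)(1-t_j)e_i+e_k+(1-t_k)(t_i-1)e_j$ for $i<k<j$; $\varphi_G(a_{i,j})e_j=(1-t_j)e_i+t_ie_j$. *)

theory Defs
  imports
    "HOL-Algebra.Bij"
    "HOL-Algebra.Sym_Groups"
    "HOL-Algebra.Ring"
    "HOL-Algebra.Module"
    "HOL-Library.Poly_Mapping"
begin

section \<open>Free groups and group presentations\<close>

text \<open>
  Elements of the free group are reduced words; the letter \<open>(x, True)\<close> stands for the
  generator \<open>x\<close> and \<open>(x, False)\<close> for its inverse.  The group operation is written
  additively (class \<open>group_add\<close> is not commutative), so that \<^typ>\<open>'a \<Rightarrow>\<^sub>0 int\<close> with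
  \<open>'a\<close> a free group is the integral group ring with its convolution product.
\<close>

abbreviation (input) flip :: "'a \<times> bool \<Rightarrow> 'a \<times> bool"
  where "flip a \<equiv> (fst a, \<not> snd a)"

definition reduced :: "('a \<times> bool) list \<Rightarrow> bool"
  where "reduced w \<longleftrightarrow> successively (\<lambda>a b. b \<noteq> flip a) w"

fun cons_red :: "'a \<times> bool \<Rightarrow> ('a \<times> bool) list \<Rightarrow> ('a \<times> bool) list"
  where
    "cons_red a [] = [a]"
  | "cons_red a (b # w) = (if b = flip a then w else a # b # w)"

lemma reduced_Nil [simp]: "reduced []"
  and reduced_single [simp]: "reduced [a]"
  and reduced_Cons2: "reduced (a # b # w) \<longleftrightarrow> b \<noteq> flip a \<and> reduced (b # w)"
  by (simp_all add: reduced_def)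

lemma reduced_tl: "reduced (a # w) \<Longrightarrow> reduced w"
  by (cases w) (simp_all add: reduced_Cons2)

lemma reduced_cons_red: "reduced w \<Longrightarrow> reduced (cons_red a w)"
  by (cases w) (auto simp: reduced_Cons2 dest: reduced_tl)

lemma reduced_foldr_cons_red: "reduced v \<Longrightarrow> reduced (foldr cons_red u v)"
  by (induction u) (auto intro: reduced_cons_red)

lemma cons_red_eq_Cons: "reduced (a # w) \<Longrightarrow> cons_red a w = a # w"
  by (cases w) (simp_all add: reduced_Cons2)

lemma cons_red_flip: "reduced w \<Longrightarrow> cons_red a (cons_red (flip a) w) = w"
proof (cases w)
  case (Cons b v)
  assume w: "reduced w"
  show ?thesis
  proof (cases "b = a")
    case True
    then show ?thesis using w Cons by (simp add: cons_red_eq_Cons)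
  next
    case False
    then show ?thesis using Cons by (cases a; cases b) auto
  qed
qed simp

lemma foldr_cons_red_cons_red:
  assumes "reduced v" "reduced u"
  shows "foldr cons_red (cons_red a u) v = cons_red a (foldr cons_red u v)"
proof (cases u)
  case (Cons b u')
  show ?thesis
  proof (cases "b = flip a")
    case True
    then show ?thesis
      using Cons cons_red_flip[OF reduced_foldr_cons_red[OF assms(1)], of a u'] by simp
  next
    case False
    then show ?thesis using Cons by simp
  qed
qed simp

lemma foldr_cons_red_assoc:
  assumes "reduced v" "reduced w"
  shows "foldr cons_red (foldr cons_red u v) w = foldr cons_red u (foldr cons_red v w)"
  by (induction u)
    (simp_all add: foldr_cons_red_cons_red reduced_foldr_cons_red assms)

lemma foldr_cons_red_Nil: "reduced u \<Longrightarrow> foldr cons_red u [] = u"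
proof (induction u)
  case (Cons a u)
  then show ?case
    using cons_red_eq_Cons[OF Cons.prems] by (simp add: reduced_tl)
qed simp

lemma foldr_cons_red_inverse:
  "foldr cons_red (rev (map (\<lambda>a. flip a) u) @ u) [] = []"
proof (induction u rule: rev_induct)
  case (snoc a u)
  have *: "foldr cons_red (rev (map (\<lambda>a. flip a) u)) (foldr cons_red u v) = v" if "reduced v" for v
    using that
  proof (induction u arbitrary: v)
    case (Cons b u)
    have "reduced (foldr cons_red u v)"
      using Cons.prems by (rule reduced_foldr_cons_red)
    from cons_red_flip[OF this, of "flip b"] Cons show ?case by simp
  qed simp
  show ?case using *[of "[a]"] by simp
qed simp

lemma reduced_rev_flip: "reduced u \<Longrightarrow> reduced (rev (map (\<lambda>a. flip a) u))"
  unfolding reduced_def successively_rev successively_map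
  by (erule successively_mono) auto

typedef 'a free_group = "{w :: ('a \<times> bool) list. reduced w}"
  morphisms word_of Abs_free_group
  by (rule exI[of _ "[]"]) simp

setup_lifting type_definition_free_group

instantiation free_group :: (type) group_add
begin

lift_definition zero_free_group :: "'a free_group" is "[]"
  by simp

lift_definition plus_free_group :: "'a free_group \<Rightarrow> 'a free_group \<Rightarrow> 'a free_group"
  is "foldr cons_red"
  by (rule reduced_foldr_cons_red)

lift_definition uminus_free_group :: "'a free_group \<Rightarrow> 'a free_group"
  is "\<lambda>w. rev (map (\<lambda>a. flip a) w)"
  by (rule reduced_rev_flip)

definition minus_free_group :: "'a free_group \<Rightarrow> 'a free_group \<Rightarrow> 'a free_group"
  where "minus_free_group u v = u + - v"

instance
proof
  fix a b c :: "'a free_group"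
  show "a + b + c = a + (b + c)"
    by transfer (rule foldr_cons_red_assoc)
  show "0 + a = a"
    by transfer simp
  show "a + 0 = a"
    by transfer (rule foldr_cons_red_Nil)
  show "- a + a = 0"
  proof transfer
    fix w :: "('a \<times> bool) list"
    assume "reduced w"
    then show "foldr cons_red (rev (map (\<lambda>a. flip a) w)) w = []"
      using foldr_cons_red_inverse[of w] by (simp add: foldr_cons_red_Nil)
  qed
  show "a + - b = a - b"
    by (simp add: minus_free_group_def)
qed

end

lift_definition gen :: "'a \<Rightarrow> 'a free_group" is "\<lambda>x. [(x, True)]"
  by simp

definition Free :: "'a set \<Rightarrow> 'a free_group monoid"
  where "Free S = \<lparr>carrier = {w. fst ` set (word_of w) \<subseteq> S}, monoid.mult = (+), one = 0\<rparr>"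

definition free_lift :: "('g, 'm) monoid_scheme \<Rightarrow> ('a \<Rightarrow> 'g) \<Rightarrow> 'a free_group \<Rightarrow> 'g"
  where "free_lift G f w =
    foldr (\<lambda>(x, b) y. (if b then f x else inv\<^bsub>G\<^esub> f x) \<otimes>\<^bsub>G\<^esub> y) (word_of w) \<one>\<^bsub>G\<^esub>"

definition normal_closure :: "('g, 'm) monoid_scheme \<Rightarrow> 'g set \<Rightarrow> 'g set"
  where "normal_closure G S = \<Inter> {N. N \<lhd> G \<and> S \<subseteq> N}"

text \<open>
  Maps act on the right, i.e. the product \<open>f g\<close> in an automorphism group is
  ``first \<open>f\<close>, then \<open>g\<close>''.  The groups of bijections in the library use the other order.
\<close>

definition opposite :: "('g, 'm) monoid_scheme \<Rightarrow> ('g, 'm) monoid_scheme"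
  where "opposite G = G\<lparr>monoid.mult := \<lambda>x y. y \<otimes>\<^bsub>G\<^esub> x\<rparr>"

definition Aut :: "('g, 'm) monoid_scheme \<Rightarrow> ('g \<Rightarrow> 'g) monoid"
  where "Aut G = opposite (AutoGroup G)"


section \<open>Braid groups\<close>

definition braid_relators :: "nat \<Rightarrow> nat free_group set"
  where "braid_relators n =
    {(gen i + gen (i + 1) + gen i) - (gen (i + 1) + gen i + gen (i + 1)) | i.
        1 \<le> i \<and> i + 2 \<le> n}
    \<union> {(gen i + gen j) - (gen j + gen i) | i j.
        i \<in> {1..<n} \<and> j \<in> {1..<n} \<and> (i + 2 \<le> j \<or> j + 2 \<le> i)}"

definition braid_kernel :: "nat \<Rightarrow> nat free_group set"
  where "braid_kernel n = normal_closure (Free {1..<n}) (braid_relators n)"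

definition Braid :: "nat \<Rightarrow> nat free_group set monoid"
  where "Braid n = Free {1..<n} Mod braid_kernel n"

definition sigma :: "nat \<Rightarrow> nat \<Rightarrow> nat free_group set"
  where "sigma n i = braid_kernel n #>\<^bsub>Free {1..<n}\<^esub> gen i"

text \<open>
  The map on the braid group induced by an assignment of the generators: a coset is sent to the
  common value of its elements.  It is only meaningful if the assignment respects the relations.
\<close>

definition braid_lift :: "('g, 'm) monoid_scheme \<Rightarrow> (nat \<Rightarrow> 'g) \<Rightarrow> nat free_group set \<Rightarrow> 'g"
  where "braid_lift G f b = the_elem (free_lift G f ` b)"

definition braid_perm :: "nat \<Rightarrow> nat free_group set \<Rightarrow> nat \<Rightarrow> nat"
  where "braid_perm n = braid_lift (opposite (sym_group n)) (\<lambda>i. transpose i (i + 1))"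

definition Pure_braid :: "nat \<Rightarrow> nat free_group set monoid"
  where "Pure_braid n =
    (Braid n)\<lparr>carrier := kernel (Braid n) (opposite (sym_group n)) (braid_perm n)\<rparr>"

definition pure_conj :: "nat \<Rightarrow> nat \<Rightarrow> nat \<Rightarrow> nat free_group set"
  where "pure_conj n i j =
    foldr (\<lambda>k b. sigma n k \<otimes>\<^bsub>Braid n\<^esub> b) (rev [i + 1..<j]) \<one>\<^bsub>Braid n\<^esub>"

definition pure_gen :: "nat \<Rightarrow> nat \<Rightarrow> nat \<Rightarrow> nat free_group set"
  where "pure_gen n i j =
    pure_conj n i j \<otimes>\<^bsub>Braid n\<^esub> (sigma n i [^]\<^bsub>Braid n\<^esub> (2::nat)) \<otimes>\<^bsub>Braid n\<^esub>
      inv\<^bsub>Braid n\<^esub> (pure_conj n i j)"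

definition artin_gen :: "nat \<Rightarrow> nat \<Rightarrow> nat free_group \<Rightarrow> nat free_group"
  where "artin_gen n i = (\<lambda>w \<in> carrier (Free {1..n}).
    free_lift (Free {1..n})
      (\<lambda>k. if k = i then gen i + gen (i + 1) - gen i
           else if k = i + 1 then gen i
           else gen k) w)"

definition artin :: "nat \<Rightarrow> nat free_group set \<Rightarrow> nat free_group \<Rightarrow> nat free_group"
  where "artin n = braid_lift (Aut (Free {1..n})) (artin_gen n)"


section \<open>Laurent polynomials and the free module\<close>

text \<open>
  A Laurent polynomial is a finitely supported map from exponent vectors to integers, i.e. an
  element of the integral group ring of the free abelian group \<^typ>\<open>nat \<Rightarrow>\<^sub>0 int\<close>.
\<close>

type_synonym laurent = "(nat \<Rightarrow>\<^sub>0 int) \<Rightarrow>\<^sub>0 int"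

abbreviation var_pow :: "nat \<Rightarrow> int \<Rightarrow> laurent"
  where "var_pow k e \<equiv> Poly_Mapping.single (Poly_Mapping.single k e) 1"

abbreviation var :: "nat \<Rightarrow> laurent"
  where "var k \<equiv> var_pow k 1"

definition Laurent :: "nat \<Rightarrow> laurent ring"
  where "Laurent n = \<lparr>carrier = {\<alpha>. \<forall>m \<in> Poly_Mapping.keys \<alpha>. Poly_Mapping.keys m \<subseteq> {1..n}},
    monoid.mult = (*), one = 1, zero = 0, add = (+)\<rparr>"

abbreviation scale :: "laurent \<Rightarrow> (nat \<Rightarrow>\<^sub>0 laurent) \<Rightarrow> (nat \<Rightarrow>\<^sub>0 laurent)"
  where "scale \<alpha> v \<equiv> Poly_Mapping.map ((*) \<alpha>) v"

text \<open>Only the carrier, the addition and the scalar multiplication of a module record matter.\<close>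

definition Free_mod :: "nat \<Rightarrow> (laurent, nat \<Rightarrow>\<^sub>0 laurent) module"
  where "Free_mod n = \<lparr>carrier = {v. Poly_Mapping.keys v \<subseteq> {1..n} \<and>
      (\<forall>k. Poly_Mapping.lookup v k \<in> carrier (Laurent n))},
    monoid.mult = undefined, one = undefined, zero = 0, add = (+), smult = scale\<rparr>"

abbreviation basis :: "nat \<Rightarrow> (nat \<Rightarrow>\<^sub>0 laurent)"
  where "basis k \<equiv> Poly_Mapping.single k 1"

abbreviation "Free_add n \<equiv> add_monoid (Free_mod n)"

definition GL :: "nat \<Rightarrow> ((nat \<Rightarrow>\<^sub>0 laurent) \<Rightarrow> (nat \<Rightarrow>\<^sub>0 laurent)) monoid"
  where "GL n = (Aut (Free_add n))\<lparr>carrier := {f \<in> carrier (Aut (Free_add n)).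
    \<forall>\<alpha> \<in> carrier (Laurent n). \<forall>v \<in> carrier (Free_mod n).
      f (\<alpha> \<odot>\<^bsub>Free_mod n\<^esub> v) = \<alpha> \<odot>\<^bsub>Free_mod n\<^esub> f v}\<rparr>"


section \<open>The Gassner representation\<close>

fun fox_word :: "nat \<Rightarrow> (nat \<times> bool) list \<Rightarrow> (nat free_group \<Rightarrow>\<^sub>0 int)"
  where
    "fox_word s [] = 0"
  | "fox_word s ((i, True) # w) =
      (if i = s then 1 else 0) + Poly_Mapping.single (gen i) 1 * fox_word s w"
  | "fox_word s ((i, False) # w) =
      Poly_Mapping.single (- gen i) 1 * (fox_word s w - (if i = s then 1 else 0))"

text \<open>
  The Fox derivative with respect to \<open>s\<close>, computed from \<open>\<partial>(u v) = \<partial>u + u \<partial>v\<close> by splitting off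
  the first letter of a reduced word.
\<close>

definition fox :: "nat \<Rightarrow> nat free_group \<Rightarrow> (nat free_group \<Rightarrow>\<^sub>0 int)"
  where "fox s w = fox_word s (word_of w)"

definition abel :: "(nat free_group \<Rightarrow>\<^sub>0 int) \<Rightarrow> laurent"
  where "abel \<xi> = (\<Sum>w \<in> Poly_Mapping.keys \<xi>. of_int (Poly_Mapping.lookup \<xi> w) *
    (\<Prod>(i, b) \<leftarrow> word_of w. var_pow i (if b then 1 else - 1)))"

definition gassner_matrix :: "nat \<Rightarrow> nat free_group set \<Rightarrow> nat \<Rightarrow> nat \<Rightarrow> laurent"
  where "gassner_matrix n p r s = abel (fox s (artin n p (gen r)))"

text \<open>
  The Gassner representation is the homomorphism with prescribed matrices on the generators
  \<open>a\<^sub>i\<^sub>j\<close> of the pure braid group; a matrix \<open>m\<close> is identified with the linear map sending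
  \<open>e\<^sub>r\<close> to \<open>\<Sum>\<^sub>s m\<^sub>r\<^sub>s e\<^sub>s\<close>.
\<close>

definition is_gassner :: "nat \<Rightarrow>
    (nat free_group set \<Rightarrow> (nat \<Rightarrow>\<^sub>0 laurent) \<Rightarrow> (nat \<Rightarrow>\<^sub>0 laurent)) \<Rightarrow> bool"
  where "is_gassner n \<psi> \<longleftrightarrow> \<psi> \<in> hom (Pure_braid n) (GL n) \<and>
    (\<forall>i j. 1 \<le> i \<and> i < j \<and> j \<le> n \<longrightarrow>
      (\<forall>r \<in> {1..n}. \<psi> (pure_gen n i j) (basis r) =
        (\<Sum>s = 1..n. scale (gassner_matrix n (pure_gen n i j) r s) (basis s))))"


section \<open>The representation on the additive group\<close>

text \<open>
  The automorphism of the Laurent polynomial ring swapping \<open>t\<^sub>j\<close> and \<open>t\<^sub>j\<^sub>+\<^sub>1\<close>.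
  \<open>map_key f\<close> is precomposition with \<open>f\<close>; as the transposition is an involution, this
  moves the coefficient of each monomial to the monomial with the variables swapped.
\<close>

definition swap_vars :: "nat \<Rightarrow> laurent \<Rightarrow> laurent"
  where "swap_vars j =
    Poly_Mapping.map_key (Poly_Mapping.map_key (transpose j (j + 1)))"

definition R_basis :: "nat \<Rightarrow> nat \<Rightarrow> (nat \<Rightarrow>\<^sub>0 laurent)"
  where "R_basis j k =
    (if k = j then scale (1 - var (j + 1)) (basis j) + scale (var j) (basis (j + 1))
     else if k = j + 1 then basis j
     else basis k)"

definition R_map :: "nat \<Rightarrow> nat \<Rightarrow> (nat \<Rightarrow>\<^sub>0 laurent) \<Rightarrow> (nat \<Rightarrow>\<^sub>0 laurent)"
  where "R_map n j = (\<lambda>v \<in> carrier (Free_mod n).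
    \<Sum>k = 1..n. scale (swap_vars j (Poly_Mapping.lookup v k)) (R_basis j k))"

definition phi2B :: "nat \<Rightarrow> nat free_group set \<Rightarrow> (nat \<Rightarrow>\<^sub>0 laurent) \<Rightarrow> (nat \<Rightarrow>\<^sub>0 laurent)"
  where "phi2B n = braid_lift (Aut (Free_add n)) (R_map n)"

end

theory Submission
  imports Defs
begin

text \<open>
  The Fox derivatives assemble into a crossed homomorphism
  \<open>D w = \<Sum>\<^sub>s (\<partial>w/\<partial>x\<^sub>s)\<^sup>a\<^sup>b e\<^sub>s\<close> from the free group to the free module, with
  \<open>D x\<^sub>r = e\<^sub>r\<close>.  Checking free generators shows that \<open>R\<^sub>j (D w) = D (\<phi>\<^sub>A(\<sigma>\<^sub>j) w)\<close>, so \<open>D\<close>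
  intertwines the Artin action of any braid with its action by the maps \<open>R\<^sub>j\<close>.  Evaluating at
  \<open>w = x\<^sub>r\<close> says that every braid \<open>b\<close> sends \<open>e\<^sub>r\<close> to row \<open>r\<close> of its Fox matrix, without
  computing the matrix of any \<open>a\<^sub>i\<^sub>j\<close>.  Moreover \<open>b\<close> acts semilinearly with respect to the
  permutation of the variables induced by \<open>b\<close>, hence linearly if \<open>b\<close> is pure.  Uniqueness
  needs that the \<open>a\<^sub>i\<^sub>j\<close> generate the pure braid group: the subgroup \<open>H\<close> they generate
  contains the squares \<open>\<sigma>\<^sub>k\<^sup>2\<close> and is normalised by all \<open>\<sigma>\<^sub>k\<close>, so a braid on \<open>m + 1\<close>
  strands lies in \<open>H v \<sigma>\<^sub>m \<dots> \<sigma>\<^sub>i\<^sub>+\<^sub>1\<close> for some \<open>i \<le> m\<close> and some \<open>v\<close> on \<open>m\<close> strands; its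
  permutation sends \<open>m + 1\<close> to \<open>i + 1\<close>, and induction on \<open>m\<close> applies.
\<close>

section \<open>Free groups and automorphism groups\<close>

lemma set_foldr_cons_red: "fst ` set (foldr cons_red u v) \<subseteq> fst ` set u \<union> fst ` set v"
proof (induction u)
  case (Cons a u)
  have "fst ` set (cons_red a w) \<subseteq> insert (fst a) (fst ` set w)" for w
    by (cases w) auto
  then have "fst ` set (cons_red a (foldr cons_red u v)) \<subseteq>
      insert (fst a) (fst ` set u \<union> fst ` set v)"
    using Cons by (meson insert_mono order_trans)
  then show ?case by simp
qed simp

text \<open>Reduction only deletes adjacent opposite letters, and these act on \<open>Y\<close> by
  mutually inverse maps. With letters acting by multiplication this gives the universal property and
  \<open>ab_add\<close>; with letters acting by affine maps it gives the product rule for Fox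
  derivatives.\<close>

lemma foldr_foldr_cons_red:
  assumes closed: "\<And>a y. fst a \<in> S \<Longrightarrow> y \<in> Y \<Longrightarrow> g a y \<in> Y"
    and cancel: "\<And>a y. fst a \<in> S \<Longrightarrow> y \<in> Y \<Longrightarrow> g a (g (flip a) y) = y"
    and u: "fst ` set u \<subseteq> S" and v: "fst ` set v \<subseteq> S" and z: "z \<in> Y"
  shows "foldr g (foldr cons_red u v) z = foldr g u (foldr g v z)"
proof -
  have closed': "foldr g w z \<in> Y" if "fst ` set w \<subseteq> S" for w
    using that z by (induction w) (auto intro: closed)
  have cons: "foldr g (cons_red a w) z = g a (foldr g w z)"
    if "fst a \<in> S" "fst ` set w \<subseteq> S" for a w
  proof (cases w)
    case (Cons b w')
    have "foldr g w' z \<in> Y" using that Cons by (intro closed') auto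
    then show ?thesis using cancel[OF that(1)] Cons by auto
  qed simp
  have set_foldr: "fst ` set (foldr cons_red w v) \<subseteq> S" if "fst ` set w \<subseteq> S" for w
    using set_foldr_cons_red[of w v] that v by (meson Un_least order_trans)
  from u show ?thesis
    by (induction u) (simp_all add: cons set_foldr)
qed

lemma carrier_Free: "w \<in> carrier (Free S) \<longleftrightarrow> fst ` set (word_of w) \<subseteq> S"
  by (simp add: Free_def)

lemma mult_Free [simp]: "u \<otimes>\<^bsub>Free S\<^esub> v = u + v"
  and one_Free [simp]: "\<one>\<^bsub>Free S\<^esub> = 0"
  by (simp_all add: Free_def)

lemma gen_in_Free [simp]: "gen x \<in> carrier (Free S) \<longleftrightarrow> x \<in> S"
  by (simp add: carrier_Free gen.rep_eq)

lemma zero_in_Free [simp]: "0 \<in> carrier (Free S)"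
  by (simp add: carrier_Free zero_free_group.rep_eq)

lemma uminus_in_Free [simp]: "- w \<in> carrier (Free S) \<longleftrightarrow> w \<in> carrier (Free S)"
  by (simp add: carrier_Free uminus_free_group.rep_eq image_image)

lemma plus_in_Free [simp]:
  assumes "u \<in> carrier (Free S)" "v \<in> carrier (Free S)"
  shows "u + v \<in> carrier (Free S)"
  using assms set_foldr_cons_red[of "word_of u" "word_of v"]
  unfolding carrier_Free plus_free_group.rep_eq by (meson Un_least order_trans)

lemma minus_in_Free [simp]:
  "u \<in> carrier (Free S) \<Longrightarrow> v \<in> carrier (Free S) \<Longrightarrow> u - v \<in> carrier (Free S)"
  using plus_in_Free[of u S "- v"] by simp

lemma group_Free [simp]: "group (Free S)"
proof (rule groupI)
  fix x assume "x \<in> carrier (Free S)"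
  then show "\<exists>y\<in>carrier (Free S). y \<otimes>\<^bsub>Free S\<^esub> x = \<one>\<^bsub>Free S\<^esub>"
    by (intro bexI[of _ "- x"]) auto
qed (auto simp: add.assoc)

lemma inv_Free: "w \<in> carrier (Free S) \<Longrightarrow> inv\<^bsub>Free S\<^esub> w = - w"
  by (rule group.inv_equality) auto

lemma word_of_cases:
  obtains "w = 0" | x v where "w = gen x + v" "word_of w = (x, True) # word_of v"
    | x v where "w = - gen x + v" "word_of w = (x, False) # word_of v"
proof (cases "word_of w")
  case Nil
  then show ?thesis using that(1) by (metis word_of_inject zero_free_group.rep_eq)
next
  case (Cons a u)
  have red: "reduced (a # u)" using word_of[of w] Cons by simp
  define v where "v = Abs_free_group u"
  have v: "word_of v = u"
    using reduced_tl[OF red] by (simp add: v_def Abs_free_group_inverse)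
  obtain x b where a: "a = (x, b)" by (cases a)
  have "w = (if b then gen x else - gen x) + v"
    by (rule word_of_inject[THEN iffD1])
      (use cons_red_eq_Cons[OF red] in
        \<open>auto simp: plus_free_group.rep_eq uminus_free_group.rep_eq gen.rep_eq v Cons a\<close>)
  with that(2,3) a v Cons show ?thesis by (cases b) auto
qed

text \<open>Peeling off the first letter of a reduced word shortens it. The cases speak of sums in
  the group, so that an induction by this rule involves neither words nor reducedness.\<close>

lemma Free_induct [consumes 1, case_names zero gen minus_gen]:
  assumes "w \<in> carrier (Free S)" and "P 0"
    and gen: "\<And>x v. x \<in> S \<Longrightarrow> v \<in> carrier (Free S) \<Longrightarrow> P v \<Longrightarrow> P (gen x + v)"
    and minus_gen: "\<And>x v. x \<in> S \<Longrightarrow> v \<in> carrier (Free S) \<Longrightarrow> P v \<Longrightarrow> P (- gen x + v)"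
  shows "P w"
  using assms(1)
proof (induction "length (word_of w)" arbitrary: w)
  case 0
  then show ?case using assms(2) by (cases w rule: word_of_cases) auto
next
  case (Suc k)
  show ?case
  proof (cases w rule: word_of_cases)
    case 1
    then show ?thesis using assms(2) by simp
  next
    case (2 x v)
    then have "v \<in> carrier (Free S)" "x \<in> S" using Suc.prems by (auto simp: carrier_Free)
    with 2 Suc.hyps show ?thesis by (auto intro!: gen)
  next
    case (3 x v)
    then have "v \<in> carrier (Free S)" "x \<in> S" using Suc.prems by (auto simp: carrier_Free)
    with 3 Suc.hyps show ?thesis by (auto intro!: minus_gen)
  qed
qed

lemma (in group) free_lift_gen: "f x \<in> carrier G \<Longrightarrow> free_lift G f (gen x) = f x"
  by (simp add: free_lift_def gen.rep_eq)

lemma (in group) free_lift_hom: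
  assumes "\<And>x. x \<in> S \<Longrightarrow> f x \<in> carrier G"
  shows "free_lift G f \<in> hom (Free S) G"
proof (rule homI)
  let ?g = "\<lambda>(x, b) y. (if b then f x else inv f x) \<otimes> y"
  have closed: "foldr ?g w y \<in> carrier G"
    if "fst ` set w \<subseteq> S" "y \<in> carrier G" for w y
    using that assms by (induction w) auto
  then show "free_lift G f w \<in> carrier G" if "w \<in> carrier (Free S)" for w
    using that by (simp add: free_lift_def carrier_Free)
  fix u v assume uv: "u \<in> carrier (Free S)" "v \<in> carrier (Free S)"
  let ?z = "foldr ?g (word_of v) \<one>"
  have "foldr ?g (foldr cons_red (word_of u) (word_of v)) \<one> = foldr ?g (word_of u) ?z"
    by (rule foldr_foldr_cons_red[where S = S and Y = "carrier G"])
      (use uv assms in \<open>auto simp: carrier_Free simp flip: m_assoc\<close>)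
  also have "\<dots> = foldr ?g (word_of u) \<one> \<otimes> ?z"
  proof -
    \<comment> \<open>The letters multiply on the left, hence commute with right multiplication by
      the starting value.\<close>
    have "foldr ?g w y = foldr ?g w \<one> \<otimes> y"
      if "fst ` set w \<subseteq> S" "y \<in> carrier G" for w y
      using that assms closed by (induction w) (auto simp: m_assoc)
    moreover have "fst ` set (word_of u) \<subseteq> S" "?z \<in> carrier G"
      using uv by (auto intro!: closed simp: carrier_Free)
    ultimately show ?thesis .
  qed
  finally show "free_lift G f (u \<otimes>\<^bsub>Free S\<^esub> v) = free_lift G f u \<otimes> free_lift G f v"
    unfolding free_lift_def mult_Free plus_free_group.rep_eq .
qed

lemma (in group) hom_Free_eqI:
  assumes "h \<in> hom (Free S) G" "k \<in> hom (Free S) G"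
    and eq: "\<And>x. x \<in> S \<Longrightarrow> h (gen x) = k (gen x)" and "w \<in> carrier (Free S)"
  shows "h w = k w"
proof -
  interpret h: group_hom "Free S" G h
    using assms(1) by (intro group_hom.intro group_hom_axioms.intro) auto
  interpret k: group_hom "Free S" G k
    using assms(2) by (intro group_hom.intro group_hom_axioms.intro) auto
  from assms(4) show ?thesis
  proof (induction rule: Free_induct)
    case zero
    show ?case using h.hom_one k.hom_one by simp
  next
    case (gen x v)
    then show ?case using h.hom_mult[of "gen x" v] k.hom_mult[of "gen x" v] eq by simp
  next
    case (minus_gen x v)
    then show ?case
      using h.hom_mult[of "- gen x" v] k.hom_mult[of "- gen x" v] h.hom_inv[of "gen x"]
        k.hom_inv[of "gen x"] eq by (simp add: inv_Free)
  qed
qed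

lemma normal_normal_closure:
  assumes "group G" "S \<subseteq> carrier G"
  shows "normal_closure G S \<lhd> G" "S \<subseteq> normal_closure G S"
    and "\<And>N. N \<lhd> G \<Longrightarrow> S \<subseteq> N \<Longrightarrow> normal_closure G S \<subseteq> N"
proof -
  interpret group G by fact
  let ?F = "{N. N \<lhd> G \<and> S \<subseteq> N}"
  \<comment> \<open>This member makes the family nonempty, so that its intersection is a
    subgroup.\<close>
  have F: "carrier G \<in> ?F" using assms normal_self by auto
  have sub: "subgroup (\<Inter>?F) G"
    using F by (intro subgroups_Inter) (auto dest: normal_imp_subgroup)
  show "normal_closure G S \<lhd> G"
    unfolding normal_closure_def
    by (rule normal_invI[OF sub]) (auto intro: normal.inv_op_closed2)
qed (auto simp: normal_closure_def)

section \<open>Automorphism groups whose left factor acts first\<close>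

lemma group_opposite:
  assumes "group G"
  shows "group (opposite G)"
proof -
  interpret group G by fact
  show ?thesis
  proof (rule groupI)
    fix x assume "x \<in> carrier (opposite G)"
    then show "\<exists>y\<in>carrier (opposite G). y \<otimes>\<^bsub>opposite G\<^esub> x = \<one>\<^bsub>opposite G\<^esub>"
      by (intro bexI[of _ "inv\<^bsub>G\<^esub> x"]) (auto simp: opposite_def)
  qed (auto simp: opposite_def m_assoc)
qed

lemma group_Aut: "group G \<Longrightarrow> group (Aut G)"
  unfolding Aut_def by (intro group_opposite group.AutoGroup)

lemma carrier_Aut:
  "f \<in> carrier (Aut G) \<longleftrightarrow>
    f \<in> hom G G \<and> f \<in> extensional (carrier G) \<and> bij_betw f (carrier G) (carrier G)"
  by (simp add: Aut_def opposite_def AutoGroup_def auto_def Bij_def)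

lemma mult_Aut:
  "f \<in> carrier (Aut G) \<Longrightarrow> g \<in> carrier (Aut G) \<Longrightarrow> f \<otimes>\<^bsub>Aut G\<^esub> g = compose (carrier G) g f"
  by (simp add: Aut_def opposite_def AutoGroup_def auto_def BijGroup_def)

lemma mult_Aut_apply:
  "f \<in> carrier (Aut G) \<Longrightarrow> g \<in> carrier (Aut G) \<Longrightarrow> x \<in> carrier G \<Longrightarrow> (f \<otimes>\<^bsub>Aut G\<^esub> g) x = g (f x)"
  by (simp add: mult_Aut compose_def)

lemma one_Aut: "\<one>\<^bsub>Aut G\<^esub> = (\<lambda>x \<in> carrier G. x)"
  by (simp add: Aut_def opposite_def AutoGroup_def BijGroup_def)

lemma Aut_closed: "f \<in> carrier (Aut G) \<Longrightarrow> x \<in> carrier G \<Longrightarrow> f x \<in> carrier G"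
  by (auto simp: carrier_Aut hom_def)

lemma carrier_AutI:
  assumes "f \<in> hom G G" "f \<in> extensional (carrier G)"
    and "\<And>x. x \<in> carrier G \<Longrightarrow> g x \<in> carrier G"
    and "\<And>x. x \<in> carrier G \<Longrightarrow> f (g x) = x" "\<And>x. x \<in> carrier G \<Longrightarrow> g (f x) = x"
  shows "f \<in> carrier (Aut G)"
  unfolding carrier_Aut using assms
  by (auto intro!: bij_betw_byWitness[where f' = g] dest: hom_in_carrier)

lemma Aut_eqI:
  assumes "f \<in> carrier (Aut G)" "g \<in> carrier (Aut G)" "\<And>x. x \<in> carrier G \<Longrightarrow> f x = g x"
  shows "f = g"
  using assms by (auto simp: carrier_Aut intro: extensionalityI)

section \<open>The presentation of the braid group\<close>

text \<open>What depends only on the braid relations is done once here. The induced homomorphism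
  from \<open>Braid n\<close> is taken for three targets: the automorphisms of the free module,
  those of the free group, and the permutations. The generation of the pure subgroup is applied to
  \<open>Braid n\<close> itself.\<close>

locale braid_group_like = group G for G (structure) and s :: "nat \<Rightarrow> 'a" and n :: nat +
  assumes s_closed [simp]: "i \<in> {1..<n} \<Longrightarrow> s i \<in> carrier G"
    and braid: "1 \<le> i \<Longrightarrow> i + 2 \<le> n \<Longrightarrow>
      s i \<otimes> s (Suc i) \<otimes> s i = s (Suc i) \<otimes> s i \<otimes> s (Suc i)"
    and far_comm: "i \<in> {1..<n} \<Longrightarrow> j \<in> {1..<n} \<Longrightarrow> i + 2 \<le> j \<Longrightarrow> s i \<otimes> s j = s j \<otimes> s i"

lemma braid_relators_closed: "braid_relators n \<subseteq> carrier (Free {1..<n})"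
  by (auto simp: braid_relators_def)

lemma normal_braid_kernel: "braid_kernel n \<lhd> Free {1..<n}"
  unfolding braid_kernel_def by (intro normal_normal_closure group_Free braid_relators_closed)

lemma group_Braid: "group (Braid n)"
  unfolding Braid_def by (intro normal.factorgroup_is_group normal_braid_kernel)

definition braid_coset :: "nat \<Rightarrow> nat free_group \<Rightarrow> nat free_group set"
  where "braid_coset n w = braid_kernel n #>\<^bsub>Free {1..<n}\<^esub> w"

lemma carrier_Braid: "carrier (Braid n) = braid_coset n ` carrier (Free {1..<n})"
  by (auto simp: Braid_def carrier_FactGroup braid_coset_def)

lemma braid_coset_hom: "braid_coset n \<in> hom (Free {1..<n}) (Braid n)"
  unfolding Braid_def braid_coset_def by (intro normal.r_coset_hom_Mod normal_braid_kernel)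

lemma sigma_eq: "sigma n i = braid_coset n (gen i)"
  by (simp add: sigma_def braid_coset_def)

lemma sigma_closed [simp]: "i \<in> {1..<n} \<Longrightarrow> sigma n i \<in> carrier (Braid n)"
  by (auto simp: sigma_eq carrier_Braid)

context braid_group_like
begin

lemma free_lift_hom_braid: "free_lift G s \<in> hom (Free {1..<n}) G"
  by (rule free_lift_hom) simp

text \<open>The kernel of the free lift is normal and contains every relator, hence contains the
  normal closure, and members of one coset differ by a factor from it. This is what gives
  \<open>the_elem\<close> in \<open>braid_lift\<close> a meaning.\<close>

lemma free_lift_eq_on_coset:
  assumes "w \<in> carrier (Free {1..<n})" "v \<in> braid_coset n w"
  shows "free_lift G s v = free_lift G s w"
proof -
  interpret h: group_hom "Free {1..<n}" G "free_lift G s"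
    by (intro group_hom.intro group_hom_axioms.intro free_lift_hom_braid) auto
  have add: "free_lift G s (a + b) = free_lift G s a \<otimes> free_lift G s b"
    if "a \<in> carrier (Free {1..<n})" "b \<in> carrier (Free {1..<n})" for a b
    using h.hom_mult[OF that] by simp
  have diff: "free_lift G s (a - b) = \<one>"
    if "a \<in> carrier (Free {1..<n})" "b \<in> carrier (Free {1..<n})"
      "free_lift G s a = free_lift G s b" for a b
    using add[of a "- b"] h.hom_inv[of b] that by (simp add: inv_Free)
  have gen: "free_lift G s (gen i) = s i" if "i \<in> {1..<n}" for i
    using that by (intro free_lift_gen) simp
  have "braid_relators n \<subseteq> kernel (Free {1..<n}) G (free_lift G s)"
  proof
    fix r assume r: "r \<in> braid_relators n"
    then consider i where "1 \<le> i" "i + 2 \<le> n"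
        "r = (gen i + gen (i + 1) + gen i) - (gen (i + 1) + gen i + gen (i + 1))"
      | i j where "i \<in> {1..<n}" "j \<in> {1..<n}" "i + 2 \<le> j \<or> j + 2 \<le> i"
        "r = (gen i + gen j) - (gen j + gen i)"
      unfolding braid_relators_def by blast
    then have "free_lift G s r = \<one>"
    proof cases
      case 1
      then show ?thesis unfolding 1(3)
        by (intro diff) (use braid[of i] in \<open>auto simp: add gen\<close>)
    next
      case 2
      then show ?thesis unfolding 2(4)
        by (intro diff) (use far_comm[of i j] far_comm[of j i] in \<open>auto simp: add gen\<close>)
    qed
    with r braid_relators_closed show "r \<in> kernel (Free {1..<n}) G (free_lift G s)"
      by (auto simp: kernel_def)
  qed
  then have ker: "braid_kernel n \<subseteq> kernel (Free {1..<n}) G (free_lift G s)"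
    unfolding braid_kernel_def
    by (intro normal_normal_closure(3) h.normal_kernel braid_relators_closed) simp_all
  from assms(2) obtain k where "k \<in> braid_kernel n" "v = k + w"
    by (auto simp: braid_coset_def r_coset_def)
  with ker show ?thesis using add[of k w] assms by (auto simp: kernel_def)
qed

lemma braid_lift_coset:
  assumes "w \<in> carrier (Free {1..<n})"
  shows "braid_lift G s (braid_coset n w) = free_lift G s w"
proof -
  have "w \<in> braid_coset n w"
    unfolding braid_coset_def
    by (intro group.rcos_self group_Free assms normal_imp_subgroup normal_braid_kernel)
  then have "(\<lambda>_. free_lift G s w) ` braid_coset n w = {free_lift G s w}"
    by (rule image_constant)
  moreover have "free_lift G s ` braid_coset n w = (\<lambda>_. free_lift G s w) ` braid_coset n w"
    by (rule image_cong[OF refl]) (rule free_lift_eq_on_coset[OF assms])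
  ultimately show ?thesis by (simp only: braid_lift_def the_elem_eq)
qed

lemma braid_lift_sigma: "i \<in> {1..<n} \<Longrightarrow> braid_lift G s (sigma n i) = s i"
  by (simp add: sigma_eq braid_lift_coset free_lift_gen)

lemma braid_lift_hom: "braid_lift G s \<in> hom (Braid n) G"
proof (rule homI)
  fix x assume "x \<in> carrier (Braid n)"
  then show "braid_lift G s x \<in> carrier G"
    using free_lift_hom_braid by (auto simp: carrier_Braid braid_lift_coset hom_def)
next
  fix x y assume "x \<in> carrier (Braid n)" "y \<in> carrier (Braid n)"
  then obtain u v where u: "u \<in> carrier (Free {1..<n})" "x = braid_coset n u"
    and v: "v \<in> carrier (Free {1..<n})" "y = braid_coset n v" by (auto simp: carrier_Braid)
  have "x \<otimes>\<^bsub>Braid n\<^esub> y = braid_coset n (u + v)"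
    using hom_mult[OF braid_coset_hom u(1) v(1)] u v by simp
  then show "braid_lift G s (x \<otimes>\<^bsub>Braid n\<^esub> y) = braid_lift G s x \<otimes> braid_lift G s y"
    using hom_mult[OF free_lift_hom_braid u(1) v(1)] u v by (simp add: braid_lift_coset)
qed

end

lemma braid_group_like_Braid: "braid_group_like (Braid n) (sigma n) n"
proof -
  interpret group "Braid n" by (rule group_Braid)
  interpret h: group_hom "Free {1..<n}" "Braid n" "braid_coset n"
    by (intro group_hom.intro group_hom_axioms.intro braid_coset_hom group_Braid) auto
  have add: "braid_coset n (a + b) = braid_coset n a \<otimes>\<^bsub>Braid n\<^esub> braid_coset n b"
    if "a \<in> carrier (Free {1..<n})" "b \<in> carrier (Free {1..<n})" for a b
    using h.hom_mult[OF that] by simp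
  have rel: "braid_coset n a = braid_coset n b"
    if "a \<in> carrier (Free {1..<n})" "b \<in> carrier (Free {1..<n})" "a - b \<in> braid_relators n" for a b
  proof -
    interpret N: normal "braid_kernel n" "Free {1..<n}" by (rule normal_braid_kernel)
    have "a - b \<in> braid_kernel n"
      using that(3) normal_normal_closure(2)[OF group_Free braid_relators_closed]
      by (auto simp: braid_kernel_def)
    then have "a \<in> braid_coset n b"
      by (auto simp: braid_coset_def r_coset_def intro!: bexI[of _ "a - b"])
    then show ?thesis
      unfolding braid_coset_def
      using group.repr_independence[OF group_Free _ that(2) N.subgroup_axioms] by simp
  qed
  show ?thesis
  proof
    fix i assume i: "1 \<le> i" "i + 2 \<le> n"
    have "gen i + gen (i + 1) + gen i - (gen (i + 1) + gen i + gen (i + 1)) \<in> braid_relators n"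
      unfolding braid_relators_def using i by blast
    then show "sigma n i \<otimes>\<^bsub>Braid n\<^esub> sigma n (Suc i) \<otimes>\<^bsub>Braid n\<^esub> sigma n i =
      sigma n (Suc i) \<otimes>\<^bsub>Braid n\<^esub> sigma n i \<otimes>\<^bsub>Braid n\<^esub> sigma n (Suc i)"
      using i rel[of "gen i + gen (i + 1) + gen i" "gen (i + 1) + gen i + gen (i + 1)"]
      by (simp add: sigma_eq add)
  next
    fix i j assume ij: "i \<in> {1..<n}" "j \<in> {1..<n}" "i + 2 \<le> j"
    have "gen i + gen j - (gen j + gen i) \<in> braid_relators n"
      unfolding braid_relators_def using ij by blast
    then show "sigma n i \<otimes>\<^bsub>Braid n\<^esub> sigma n j = sigma n j \<otimes>\<^bsub>Braid n\<^esub> sigma n i"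
      using ij rel[of "gen i + gen j" "gen j + gen i"] by (simp add: sigma_eq add)
  qed simp
qed

text \<open>Every braid is the coset of a word, so this is \<open>Free_induct\<close> read through
  the projection. Generators are split off on the left, the side that acts first in the
  representations.\<close>

lemma Braid_induct [consumes 1, case_names one sigma inv_sigma]:
  assumes "b \<in> carrier (Braid n)" and "P \<one>\<^bsub>Braid n\<^esub>"
    and "\<And>i b. i \<in> {1..<n} \<Longrightarrow> b \<in> carrier (Braid n) \<Longrightarrow> P b \<Longrightarrow> P (sigma n i \<otimes>\<^bsub>Braid n\<^esub> b)"
    and "\<And>i b. i \<in> {1..<n} \<Longrightarrow> b \<in> carrier (Braid n) \<Longrightarrow> P b \<Longrightarrow>
      P (inv\<^bsub>Braid n\<^esub> (sigma n i) \<otimes>\<^bsub>Braid n\<^esub> b)"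
  shows "P b"
proof -
  interpret h: group_hom "Free {1..<n}" "Braid n" "braid_coset n"
    by (intro group_hom.intro group_hom_axioms.intro braid_coset_hom group_Braid) auto
  obtain w where w: "w \<in> carrier (Free {1..<n})" "b = braid_coset n w"
    using assms(1) by (auto simp: carrier_Braid)
  from w(1) have "P (braid_coset n w)"
  proof (induction rule: Free_induct)
    case zero
    then show ?case using assms(2) h.hom_one by simp
  next
    case (gen i v)
    then show ?case using assms(3)[of i "braid_coset n v"] h.hom_mult[of "gen i" v] h.hom_closed[of v]
      by (simp add: sigma_eq)
  next
    case (minus_gen i v)
    then show ?case using assms(4)[of i "braid_coset n v"] h.hom_mult[of "- gen i" v]
        h.hom_inv[of "gen i"] h.hom_closed[of v] by (simp add: sigma_eq inv_Free)
  qed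
  with w show ?thesis by simp
qed

section \<open>Generators of the pure braid group\<close>

definition (in group) conj_by :: "'a \<Rightarrow> 'a \<Rightarrow> 'a"
  where "conj_by x y = x \<otimes> y \<otimes> inv x"

context group
begin

lemma conj_by_closed [simp]: "x \<in> carrier G \<Longrightarrow> y \<in> carrier G \<Longrightarrow> conj_by x y \<in> carrier G"
  by (simp add: conj_by_def)

text \<open>Because of this rule an equation between products becomes an equation between nested
  conjugations, which is the form in which the braid relations act on the pure generators.\<close>

lemma conj_by_mult:
  "x \<in> carrier G \<Longrightarrow> y \<in> carrier G \<Longrightarrow> z \<in> carrier G \<Longrightarrow> conj_by (x \<otimes> y) z = conj_by x (conj_by y z)"
  by (simp add: conj_by_def m_assoc inv_mult_group)

lemma conj_by_distrib:
  "x \<in> carrier G \<Longrightarrow> y \<in> carrier G \<Longrightarrow> z \<in> carrier G \<Longrightarrow>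
    conj_by x (y \<otimes> z) = conj_by x y \<otimes> conj_by x z"
  by (simp add: conj_by_def m_assoc inv_solve_left)

lemma conj_by_one [simp]: "x \<in> carrier G \<Longrightarrow> conj_by x \<one> = \<one>"
  by (simp add: conj_by_def)

lemma conj_by_inv:
  "x \<in> carrier G \<Longrightarrow> y \<in> carrier G \<Longrightarrow> conj_by x (inv y) = inv (conj_by x y)"
  by (simp add: conj_by_def m_assoc inv_mult_group)

lemma conj_by_eq_iff:
  "x \<in> carrier G \<Longrightarrow> y \<in> carrier G \<Longrightarrow> z \<in> carrier G \<Longrightarrow>
    conj_by x y = z \<longleftrightarrow> x \<otimes> y = z \<otimes> x"
  by (auto simp: conj_by_def inv_solve_right')

lemma conj_by_inv_left:
  "x \<in> carrier G \<Longrightarrow> y \<in> carrier G \<Longrightarrow> conj_by (inv x) (conj_by x y) = y"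
  "x \<in> carrier G \<Longrightarrow> y \<in> carrier G \<Longrightarrow> conj_by x (conj_by (inv x) y) = y"
  by (simp_all flip: conj_by_mult) (simp_all add: conj_by_def)

end

context braid_group_like
begin

text \<open>Abstract counterpart of \<open>pure_conj\<close>, as \<open>pgen\<close> is of
  \<open>pure_gen\<close>; \<open>pure_gen_eq\<close> matches them. The lower index
  \<open>i = 0\<close> occurs too: the words \<open>pconj i (Suc m)\<close> with
  \<open>i \<le> m\<close> later serve as tails of coset representatives.\<close>

definition pconj :: "nat \<Rightarrow> nat \<Rightarrow> 'a"
  where "pconj i j = foldr (\<lambda>k b. s k \<otimes> b) (rev [i + 1..<j]) \<one>"

definition pgen :: "nat \<Rightarrow> nat \<Rightarrow> 'a"
  where "pgen i j = pconj i j \<otimes> (s i [^] (2::nat)) \<otimes> inv (pconj i j)"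

lemma pconj_base [simp]: "pconj i (Suc i) = \<one>"
  by (simp add: pconj_def)

lemma pconj_Suc: "i < j \<Longrightarrow> pconj i (Suc j) = s j \<otimes> pconj i j"
  by (simp add: pconj_def)

lemma pconj_closed [simp]: "i < j \<Longrightarrow> j \<le> n \<Longrightarrow> pconj i j \<in> carrier G"
proof (induction j)
  case (Suc j)
  then show ?case by (cases "i = j") (simp_all add: pconj_Suc)
qed simp

lemma pgen_base: "i \<in> {1..<n} \<Longrightarrow> pgen i (Suc i) = s i \<otimes> s i"
  by (simp add: pgen_def numeral_2_eq_2)

lemma pgen_conj: "pgen i j = conj_by (pconj i j) (s i [^] (2::nat))"
  by (simp add: pgen_def conj_by_def)

lemma pgen_closed [simp]: "1 \<le> i \<Longrightarrow> i < j \<Longrightarrow> j \<le> n \<Longrightarrow> pgen i j \<in> carrier G"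
  by (simp add: pgen_conj pconj_closed)

lemma pgen_Suc: "1 \<le> i \<Longrightarrow> i < j \<Longrightarrow> j < n \<Longrightarrow> pgen i (Suc j) = conj_by (s j) (pgen i j)"
  by (simp add: pgen_conj pconj_Suc conj_by_mult pconj_closed)

section \<open>Conjugating pure generators by braid generators\<close>

lemma far_comm_sym: "i \<in> {1..<n} \<Longrightarrow> j \<in> {1..<n} \<Longrightarrow> i + 2 \<le> j \<or> j + 2 \<le> i \<Longrightarrow> s i \<otimes> s j = s j \<otimes> s i"
  using far_comm[of i j] far_comm[of j i] by auto

lemma conj_by_s_comm:
  assumes "i \<in> {1..<n}" "j \<in> {1..<n}" "i + 2 \<le> j \<or> j + 2 \<le> i" "x \<in> carrier G"
  shows "conj_by (s i) (conj_by (s j) x) = conj_by (s j) (conj_by (s i) x)"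
  using assms far_comm_sym[of i j] by (simp flip: conj_by_mult)

lemma conj_by_s_braid:
  assumes "1 \<le> i" "i + 2 \<le> n" "x \<in> carrier G"
  shows "conj_by (s i) (conj_by (s (Suc i)) (conj_by (s i) x)) =
    conj_by (s (Suc i)) (conj_by (s i) (conj_by (s (Suc i)) x))"
  using assms braid[of i] by (simp flip: conj_by_mult m_assoc)

text \<open>\<open>pgen i j\<close> is a word in \<open>s i\<close>, ..., \<open>s (j - 1)\<close>,
  and \<open>k\<close> has distance at least two from all these indices. The induction moves
  \<open>s k\<close> past the outermost conjugation.\<close>

lemma conj_by_s_pgen_outside:
  assumes "1 \<le> i" "i < j" "j \<le> n" "k \<in> {1..<n}" "k + 2 \<le> i \<or> j + 1 \<le> k"
  shows "conj_by (s k) (pgen i j) = pgen i j"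
  using assms(2,3,5)
proof (induction j)
  case (Suc j)
  show ?case
  proof (cases "i = j")
    case True
    then have "s k \<otimes> s i = s i \<otimes> s k" using Suc.prems assms by (intro far_comm_sym) auto
    then have "conj_by (s k) (s i) = s i" using Suc.prems assms True by (simp add: conj_by_eq_iff)
    then show ?thesis using Suc.prems assms True by (simp add: pgen_base conj_by_distrib)
  next
    case False
    then have "conj_by (s k) (conj_by (s j) (pgen i j)) = conj_by (s j) (conj_by (s k) (pgen i j))"
      using Suc.prems assms False by (intro conj_by_s_comm) auto
    moreover note Suc.IH
    ultimately show ?thesis using Suc.prems assms False by (auto simp: pgen_Suc)
  qed
qed simp

text \<open>Commuting past distant outer conjugations leaves the case where the outermost two are by
  \<open>s (k + 1)\<close> and \<open>s k\<close>. There the braid relation replaces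
  \<open>s k\<close>, \<open>s (k + 1)\<close>, \<open>s k\<close> by \<open>s (k + 1)\<close>,
  \<open>s k\<close>, \<open>s (k + 1)\<close>, and the innermost of these fixes
  \<open>pgen i k\<close>.\<close>

lemma conj_by_s_pgen_inside:
  assumes "1 \<le> i" "i < k" "k + 1 < j" "j \<le> n"
  shows "conj_by (s k) (pgen i j) = pgen i j"
  using assms(3,4)
proof (induction j)
  case (Suc j)
  show ?case
  proof (cases "j = Suc k")
    case True
    then show ?thesis
      using Suc.prems assms conj_by_s_pgen_outside[of i k "Suc k"] by (simp add: pgen_Suc conj_by_s_braid)
  next
    case False
    then have "conj_by (s k) (conj_by (s j) (pgen i j)) = conj_by (s j) (conj_by (s k) (pgen i j))"
      using Suc.prems assms False by (intro conj_by_s_comm) auto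
    moreover note Suc.IH
    ultimately show ?thesis using Suc.prems assms False by (auto simp: pgen_Suc)
  qed
qed simp

lemma conj_by_s_pgen_lower:
  assumes "1 \<le> i" "Suc i < j" "j \<le> n"
  shows "conj_by (s i) (pgen i j) = pgen (Suc i) j"
  using assms(2,3)
proof (induction j)
  case (Suc j)
  show ?case
  proof (cases "j = Suc i")
    case True
    \<comment> \<open>The braid relation says that conjugation by
      \<open>s i \<otimes> s (Suc i)\<close> carries \<open>s i\<close> to \<open>s (Suc i)\<close>;
      applied to squares, this is the base case.\<close>
    have *: "conj_by (s i) (conj_by (s (Suc i)) (s i)) = s (Suc i)"
      using Suc.prems assms True braid[of i] by (simp add: conj_by_eq_iff m_assoc flip: conj_by_mult)
    have "conj_by (s i) (pgen i (Suc j)) = conj_by (s i) (conj_by (s (Suc i)) (s i \<otimes> s i))"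
      using Suc.prems assms True by (simp add: pgen_Suc pgen_base)
    also have "\<dots> = s (Suc i) \<otimes> s (Suc i)"
      using Suc.prems assms True * by (simp add: conj_by_distrib)
    also have "\<dots> = pgen (Suc i) (Suc j)"
      using Suc.prems assms True by (simp add: pgen_base)
    finally show ?thesis .
  next
    case False
    then have "conj_by (s i) (conj_by (s j) (pgen i j)) = conj_by (s j) (conj_by (s i) (pgen i j))"
      using Suc.prems assms False by (intro conj_by_s_comm) auto
    moreover note Suc.IH
    ultimately show ?thesis using Suc.prems assms False by (auto simp: pgen_Suc)
  qed
qed simp

definition pgens :: "'a set"
  where "pgens = {pgen i j | i j. 1 \<le> i \<and> i < j \<and> j \<le> n}"

lemma pgens_closed: "pgens \<subseteq> carrier G"
  by (auto simp: pgens_def)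

lemma subgroup_pure: "subgroup (generate G pgens) G"
  by (rule generate_is_subgroup[OF pgens_closed])

lemma pgen_in_pure: "1 \<le> i \<Longrightarrow> i < j \<Longrightarrow> j \<le> n \<Longrightarrow> pgen i j \<in> generate G pgens"
  by (auto simp: pgens_def intro!: generate.incl)

lemma square_in_pure: "k \<in> {1..<n} \<Longrightarrow> s k \<otimes> s k \<in> generate G pgens"
  using pgen_in_pure[of k "Suc k"] by (simp add: pgen_base)

text \<open>The position of \<open>k\<close> relative to \<open>i\<close> and \<open>j\<close>
  decides. The inverse of \<open>s k\<close> is taken when \<open>k + 1 = j\<close> with
  \<open>i < k\<close>, and when \<open>k + 1 = i\<close>: there \<open>s k\<close> carries
  \<open>pgen i k\<close>, respectively \<open>pgen k j\<close>, to the given generator.\<close>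

lemma conj_by_s_pgen_cases:
  assumes "1 \<le> i" "i < j" "j \<le> n" "k \<in> {1..<n}"
  shows "conj_by (s k) (pgen i j) \<in> generate G pgens \<or> conj_by (inv s k) (pgen i j) \<in> generate G pgens"
proof -
  consider "k + 2 \<le> i \<or> j + 1 \<le> k" | "i < k" "k + 1 < j" | "k = j" | "k + 1 = j" "i < k"
    | "k = i" "j = Suc i" | "k = i" "Suc i < j" | "Suc k = i"
    using assms by linarith
  then show ?thesis
  proof cases
    case 1
    then show ?thesis using assms by (simp add: conj_by_s_pgen_outside pgen_in_pure)
  next
    case 2
    then show ?thesis using assms by (simp add: conj_by_s_pgen_inside pgen_in_pure)
  next
    case 3
    then show ?thesis using assms pgen_in_pure[of i "Suc j"] by (simp add: pgen_Suc)
  next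
    case 4
    then show ?thesis using assms pgen_Suc[of i k] pgen_in_pure[of i k]
      by (auto simp: conj_by_inv_left)
  next
    case 5
    then have "conj_by (s k) (pgen i j) = pgen i j"
      using assms by (simp add: pgen_base conj_by_eq_iff m_assoc)
    then show ?thesis using assms by (simp add: pgen_in_pure)
  next
    case 6
    then show ?thesis using assms by (simp add: conj_by_s_pgen_lower pgen_in_pure)
  next
    case 7
    then have "pgen i j = conj_by (s k) (pgen k j)"
      using assms conj_by_s_pgen_lower[of k j] by simp
    then show ?thesis using assms 7 pgen_in_pure[of k j] by (simp add: conj_by_inv_left)
  qed
qed

lemma conj_by_mem: "subgroup H G \<Longrightarrow> x \<in> H \<Longrightarrow> y \<in> H \<Longrightarrow> conj_by x y \<in> H"
  by (simp add: conj_by_def subgroup.m_closed subgroup.m_inv_closed)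

text \<open>
  Since the square of \<open>s k\<close> lies in the subgroup, it suffices to conjugate each generator by
  one of \<open>s k\<close> and its inverse.
\<close>

lemma conj_by_s_pure:
  assumes "k \<in> {1..<n}" "x \<in> generate G pgens"
  shows "conj_by (s k) x \<in> generate G pgens" "conj_by (inv s k) x \<in> generate G pgens"
proof -
  interpret H: subgroup "generate G pgens" G by (rule subgroup_pure)
  have s2: "s k \<otimes> s k \<in> generate G pgens" "inv (s k \<otimes> s k) \<in> generate G pgens"
    using square_in_pure[OF assms(1)] H.m_inv_closed by auto
  have gen: "conj_by (s k) a \<in> generate G pgens" if "a \<in> pgens" for a
  proof -
    have a: "a \<in> carrier G" using that pgens_closed by auto
    have "conj_by (s k) a = conj_by (s k \<otimes> s k) (conj_by (inv s k) a)"
      using a assms(1) by (simp add: conj_by_mult conj_by_inv_left)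
    moreover have "conj_by (s k) a \<in> generate G pgens \<or> conj_by (inv s k) a \<in> generate G pgens"
      using that conj_by_s_pgen_cases assms(1) by (auto simp: pgens_def)
    ultimately show ?thesis using conj_by_mem[OF subgroup_pure s2(1)] by metis
  qed
  have *: "conj_by (s k) x \<in> generate G pgens" if "x \<in> generate G pgens" for x
    using that
  proof (induction rule: generate.induct)
    case one
    then show ?case using assms(1) generate.one by simp
  next
    case (incl h)
    then show ?case by (rule gen)
  next
    case (inv h)
    then show ?case using gen[of h] H.m_inv_closed pgens_closed assms(1)
      by (auto simp: conj_by_inv)
  next
    case (eng h1 h2)
    then show ?case using H.m_closed assms(1) H.subset by (auto simp: conj_by_distrib)
  qed
  show "conj_by (s k) x \<in> generate G pgens" by (rule *[OF assms(2)])
  have "conj_by (inv s k) x = conj_by (inv (s k \<otimes> s k)) (conj_by (s k) x)"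
    using assms H.subset by (auto simp: inv_mult_group conj_by_mult conj_by_inv_left)
  then show "conj_by (inv s k) x \<in> generate G pgens"
    using conj_by_mem[OF subgroup_pure s2(2)] *[OF assms(2)] by simp
qed

lemma s_image_closed: "m \<le> n \<Longrightarrow> s ` {1..<m} \<subseteq> carrier G"
  by auto

lemma subgroup_generate_s: "m \<le> n \<Longrightarrow> subgroup (generate G (s ` {1..<m})) G"
  by (intro generate_is_subgroup s_image_closed)

text \<open>Normality of the subgroup generated by \<open>pgens\<close>, in the form that moves a
  pure factor leftwards across an arbitrary product of generators.\<close>

lemma conj_by_pure:
  assumes "x \<in> generate G (s ` {1..<n})" "h \<in> generate G pgens"
  shows "conj_by x h \<in> generate G pgens"
  using assms
proof (induction x arbitrary: h rule: generate.induct)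
  case one
  then show ?case using subgroup.subset[OF subgroup_pure] by (auto simp: conj_by_def)
next
  case (eng x y)
  then have "x \<in> carrier G" "y \<in> carrier G" "h \<in> carrier G"
    using subgroup.subset[OF subgroup_pure] subgroup.subset[OF subgroup_generate_s[of n]] by auto
  with eng show ?case by (simp add: conj_by_mult)
qed (auto intro: conj_by_s_pure)

section \<open>Moving a generator across a tail \<open>pconj i m\<close>\<close>

lemma pconj_in_generate: "i < m \<Longrightarrow> m \<le> n \<Longrightarrow> pconj i m \<in> generate G (s ` {1..<m})"
proof (induction m)
  case (Suc m)
  show ?case
  proof (cases "i = m")
    case True
    then show ?thesis by (simp add: generate.one)
  next
    case False
    have "s m \<in> generate G (s ` {1..<Suc m})" using False Suc.prems by (intro generate.incl) auto
    moreover have "pconj i m \<in> generate G (s ` {1..<Suc m})"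
      using Suc False mono_generate[of "s ` {1..<m}" "s ` {1..<Suc m}"] by fastforce
    ultimately show ?thesis using Suc.prems False by (simp add: pconj_Suc generate.eng)
  qed
qed simp

lemma pconj_comm:
  assumes "i < j" "j \<le> n" "k \<in> {1..<n}" "k < i \<or> j < k"
  shows "pconj i j \<otimes> s k = s k \<otimes> pconj i j"
  using assms
proof (induction j)
  case (Suc j)
  show ?case
  proof (cases "i = j")
    case False
    have "pconj i (Suc j) \<otimes> s k = s j \<otimes> (pconj i j \<otimes> s k)"
      using Suc.prems False by (simp add: pconj_Suc m_assoc)
    also have "\<dots> = (s j \<otimes> s k) \<otimes> pconj i j"
      using Suc False by (auto simp: m_assoc)
    also have "s j \<otimes> s k = s k \<otimes> s j"
      using Suc.prems False by (intro far_comm_sym) auto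
    finally show ?thesis using Suc.prems False by (simp add: pconj_Suc m_assoc)
  qed (use Suc.prems in simp)
qed simp

lemma pconj_snoc:
  assumes "Suc i < m" "m \<le> n"
  shows "pconj (Suc i) m \<otimes> s (Suc i) = pconj i m"
  using assms
proof (induction m)
  case (Suc m)
  show ?case
  proof (cases "m = Suc i")
    case False
    then have "pconj (Suc i) (Suc m) \<otimes> s (Suc i) = s m \<otimes> (pconj (Suc i) m \<otimes> s (Suc i))"
      using Suc.prems by (simp add: pconj_Suc m_assoc)
    then show ?thesis using Suc False by (simp add: pconj_Suc)
  qed (use Suc.prems in \<open>simp add: pconj_Suc\<close>)
qed simp

text \<open>On its way left \<open>s (Suc l)\<close> commutes with the letters below
  \<open>s l\<close>, then meets \<open>s (Suc l) \<otimes> s l\<close>. The braid relation turns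
  these three letters into \<open>s l \<otimes> s (Suc l) \<otimes> s l\<close>, and the leading
  \<open>s l\<close> commutes with the rest.\<close>

lemma pconj_shift:
  assumes "i < l" "Suc l < m" "m \<le> n"
  shows "pconj i m \<otimes> s (Suc l) = s l \<otimes> pconj i m"
  using assms(2,3)
proof (induction m)
  case (Suc m)
  show ?case
  proof (cases "m = Suc l")
    case True
    have "pconj i (Suc m) \<otimes> s (Suc l) = s (Suc l) \<otimes> s l \<otimes> (pconj i l \<otimes> s (Suc l))"
      using Suc.prems assms True by (simp add: pconj_Suc m_assoc)
    also have "pconj i l \<otimes> s (Suc l) = s (Suc l) \<otimes> pconj i l"
      using Suc.prems assms by (intro pconj_comm) auto
    also have "s (Suc l) \<otimes> s l \<otimes> (s (Suc l) \<otimes> pconj i l) = s (Suc l) \<otimes> s l \<otimes> s (Suc l) \<otimes> pconj i l"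
      using Suc.prems assms by (simp add: m_assoc)
    also have "s (Suc l) \<otimes> s l \<otimes> s (Suc l) = s l \<otimes> s (Suc l) \<otimes> s l"
      using Suc.prems assms by (intro braid[symmetric]) auto
    finally show ?thesis using Suc.prems assms True by (simp add: pconj_Suc m_assoc)
  next
    case False
    then have "pconj i (Suc m) \<otimes> s (Suc l) = s m \<otimes> (pconj i m \<otimes> s (Suc l))"
      using Suc.prems assms by (simp add: pconj_Suc m_assoc)
    also have "\<dots> = (s m \<otimes> s l) \<otimes> pconj i m"
      using Suc False assms by (auto simp: m_assoc)
    also have "s m \<otimes> s l = s l \<otimes> s m"
      using Suc.prems False assms by (intro far_comm_sym) auto
    finally show ?thesis using Suc.prems assms by (simp add: pconj_Suc m_assoc)
  qed
qed simp

text \<open>The factors are a pure part, a braid on the first \<open>m\<close> strands, and one of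
  \<open>m + 1\<close> tails. The choice \<open>i = m\<close> gives the empty tail, and
  \<open>i = 0\<close> the full descending word from \<open>s m\<close> to
  \<open>s 1\<close>.\<close>

definition coset_forms :: "nat \<Rightarrow> 'a set"
  where "coset_forms m = {h \<otimes> v \<otimes> pconj i (Suc m) | h v i.
    h \<in> generate G pgens \<and> v \<in> generate G (s ` {1..<m}) \<and> i \<le> m}"

lemma coset_formsI:
  "h \<in> generate G pgens \<Longrightarrow> v \<in> generate G (s ` {1..<m}) \<Longrightarrow> i \<le> m \<Longrightarrow>
    h \<otimes> v \<otimes> pconj i (Suc m) \<in> coset_forms m"
  by (auto simp: coset_forms_def)

lemma coset_forms_closed: "m < n \<Longrightarrow> coset_forms m \<subseteq> carrier G"
  using subgroup.subset[OF subgroup_generate_s[of m]] subgroup.subset[OF subgroup_pure]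
  by (auto simp: coset_forms_def intro!: m_closed)

text \<open>By normality the new factor, conjugated by \<open>v\<close> and the tail, can be written
  to their left, where it joins \<open>h\<close>.\<close>

lemma coset_forms_mult_pure:
  assumes "m < n" "x \<in> coset_forms m" "g \<in> generate G pgens"
  shows "x \<otimes> g \<in> coset_forms m"
proof -
  interpret H: subgroup "generate G pgens" G by (rule subgroup_pure)
  obtain h v i where h: "h \<in> generate G pgens" and v: "v \<in> generate G (s ` {1..<m})"
    and i: "i \<le> m" and x: "x = h \<otimes> v \<otimes> pconj i (Suc m)"
    using assms(2) by (auto simp: coset_forms_def)
  let ?y = "v \<otimes> pconj i (Suc m)"
  have "v \<in> generate G (s ` {1..<n})"
    using v assms(1) mono_generate[of "s ` {1..<m}" "s ` {1..<n}"] by fastforce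
  moreover have "pconj i (Suc m) \<in> generate G (s ` {1..<n})"
    using pconj_in_generate[of i "Suc m"] i assms(1)
      mono_generate[of "s ` {1..<Suc m}" "s ` {1..<n}"] by fastforce
  ultimately have y: "?y \<in> generate G (s ` {1..<n})" by (rule generate.eng)
  then have "conj_by ?y g \<in> generate G pgens" using assms(3) by (rule conj_by_pure)
  then have "h \<otimes> conj_by ?y g \<otimes> v \<otimes> pconj i (Suc m) \<in> coset_forms m"
    using h v i by (intro coset_formsI H.m_closed)
  moreover have "v \<in> carrier G" "pconj i (Suc m) \<in> carrier G" "h \<in> carrier G" "g \<in> carrier G"
    using v h i assms subgroup.subset[OF subgroup_generate_s[of m]] H.subset by auto
  then have "h \<otimes> conj_by ?y g \<otimes> v \<otimes> pconj i (Suc m) = x \<otimes> g"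
    unfolding x by (simp add: conj_by_def m_assoc inv_mult_group flip: inv_mult_group)
  ultimately show ?thesis by simp
qed

text \<open>A nonempty tail ends in \<open>s (i + 1)\<close>. For \<open>k = i\<close> the tail
  grows by one letter. For \<open>k = i + 1\<close> its last letter is doubled, and the square is
  pure. For \<open>k < i\<close> the generator commutes with the tail, and for
  \<open>k > i + 1\<close> it crosses the tail as \<open>s (k - 1)\<close>; in both cases it joins
  \<open>v\<close>.\<close>

lemma coset_forms_mult_s:
  assumes "m < n" "x \<in> coset_forms m" "k \<in> {1..m}"
  shows "x \<otimes> s k \<in> coset_forms m"
proof -
  obtain h v i where h: "h \<in> generate G pgens" and v: "v \<in> generate G (s ` {1..<m})"
    and i: "i \<le> m" and x: "x = h \<otimes> v \<otimes> pconj i (Suc m)"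
    using assms(2) by (auto simp: coset_forms_def)
  have c: "v \<in> carrier G" "pconj i (Suc m) \<in> carrier G" "h \<in> carrier G" "s k \<in> carrier G"
    using v h i assms subgroup.subset[OF subgroup_generate_s[of m]] subgroup.subset[OF subgroup_pure]
    by auto
  have left: "x \<otimes> s k \<in> coset_forms m"
    if "j \<in> {1..<m}" "pconj i (Suc m) \<otimes> s k = s j \<otimes> pconj i (Suc m)" for j
  proof -
    have "s j \<in> generate G (s ` {1..<m})" using that(1) by (intro generate.incl) auto
    then have "h \<otimes> (v \<otimes> s j) \<otimes> pconj i (Suc m) \<in> coset_forms m"
      using h v i by (intro coset_formsI generate.eng)
    moreover have "s j \<in> carrier G" using that(1) assms(1) by simp
    then have "h \<otimes> (v \<otimes> s j) \<otimes> pconj i (Suc m) = x \<otimes> s k"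
      unfolding x using c that(2) by (simp add: m_assoc)
    ultimately show ?thesis by simp
  qed
  consider "k = i" | "k = Suc i" | "k < i" | "i + 1 < k" by linarith
  then show ?thesis
  proof cases
    case 1
    then obtain l where l: "i = Suc l" using assms(3) by (cases i) auto
    have "x \<otimes> s k = h \<otimes> v \<otimes> (pconj i (Suc m) \<otimes> s k)"
      unfolding x using c by (simp add: m_assoc)
    also have "pconj i (Suc m) \<otimes> s k = pconj l (Suc m)"
      using 1 l assms i pconj_snoc[of l "Suc m"] by simp
    finally show ?thesis using h v i l by (simp add: coset_formsI)
  next
    case 2
    then have *: "pconj k (Suc m) \<otimes> s k = pconj i (Suc m)"
      using assms pconj_snoc[of i "Suc m"] by simp
    have "x \<otimes> s k = h \<otimes> v \<otimes> pconj k (Suc m) \<otimes> (s k \<otimes> s k)"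
      unfolding x *[symmetric] using c assms by (simp add: m_assoc)
    moreover have "\<dots> \<in> coset_forms m"
      using h v assms by (intro coset_forms_mult_pure coset_formsI square_in_pure) auto
    ultimately show ?thesis by simp
  next
    case 3
    then show ?thesis using assms i by (intro left[of k] pconj_comm) auto
  next
    case 4
    then obtain l where "k = Suc l" by (cases k) auto
    with 4 show ?thesis using assms i by (intro left[of l]) (auto intro!: pconj_shift)
  qed
qed

lemma generate_subset_coset_forms:
  assumes "m < n" "y \<in> generate G (s ` {1..<Suc m})"
  shows "y \<in> coset_forms m"
proof -
  \<comment> \<open>Closure under right multiplication is proved for every starting form, as the
    product case of the induction requires; the claim is the case where \<open>x\<close> is the
    unit.\<close>
  have "x \<otimes> y \<in> coset_forms m" if "x \<in> coset_forms m" for x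
    using assms(2) that
  proof (induction y arbitrary: x rule: generate.induct)
    case one
    then show ?case using coset_forms_closed[OF assms(1)] by auto
  next
    case (incl h)
    then show ?case using assms(1) by (auto intro!: coset_forms_mult_s)
  next
    case (inv h)
    then obtain k where k: "k \<in> {1..m}" "h = s k"
      unfolding atLeastLessThanSuc_atLeastAtMost by blast
    have x: "x \<in> carrier G" "s k \<in> carrier G" using inv.prems k assms(1) coset_forms_closed[OF assms(1)] by auto
    \<comment> \<open>The inverse of \<open>s k\<close> equals \<open>s k\<close> times the inverse
      of a pure square, so the two closure lemmas cover it.\<close>
    have "x \<otimes> s k \<otimes> inv (s k \<otimes> s k) \<in> coset_forms m"
      using inv.prems k assms(1) subgroup.m_inv_closed[OF subgroup_pure square_in_pure[of k]]
      by (intro coset_forms_mult_pure coset_forms_mult_s) auto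
    moreover have "s k \<otimes> (inv s k \<otimes> inv s k) = inv s k"
      using x by (simp flip: m_assoc)
    ultimately show ?case using x k by (simp add: inv_mult_group m_assoc)
  next
    case (eng h1 h2)
    have "h1 \<in> carrier G" "h2 \<in> carrier G"
      using eng.hyps assms(1) subgroup.subset[OF subgroup_generate_s[of "Suc m"]] by auto
    then show ?case using eng coset_forms_closed[OF assms(1)] by (auto simp flip: m_assoc)
  qed
  moreover have "\<one> \<in> coset_forms m"
    using coset_formsI[of \<one> \<one> m m] by (simp add: generate.one)
  moreover have "y \<in> carrier G"
    using assms subgroup.subset[OF subgroup_generate_s[of "Suc m"]] by auto
  ultimately show ?thesis using l_one by metis
qed

section \<open>Permutations of braids and the kernel of the permutation map\<close>

context
  fixes \<pi>
  assumes pi_hom: "\<pi> \<in> hom G (opposite (sym_group n))"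
    and pi_s: "\<And>i. i \<in> {1..<n} \<Longrightarrow> \<pi> (s i) = transpose i (Suc i)"
begin

lemma pi_mult: "x \<in> carrier G \<Longrightarrow> y \<in> carrier G \<Longrightarrow> \<pi> (x \<otimes> y) = \<pi> y \<circ> \<pi> x"
  using hom_mult[OF pi_hom] by (simp add: opposite_def sym_group_def)

lemma pi_one [simp]: "\<pi> \<one> = id"
  using hom_one[OF pi_hom] group_opposite[OF sym_group_is_group[of n]]
  by (simp add: opposite_def sym_group_def)

text \<open>Each generator is a conjugate of the square of some \<open>s i\<close>, and a
  transposition squares to the identity.\<close>

lemma pi_pure:
  assumes "h \<in> generate G pgens"
  shows "\<pi> h = id"
proof -
  interpret h: group_hom G "opposite (sym_group n)" \<pi>
    by (intro group_hom.intro group_hom_axioms.intro pi_hom group_opposite sym_group_is_group is_group)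
  have "pgens \<subseteq> kernel G (opposite (sym_group n)) \<pi>"
  proof
    fix a assume "a \<in> pgens"
    then obtain i j where ij: "1 \<le> i" "i < j" "j \<le> n" "a = pgen i j" by (auto simp: pgens_def)
    have c: "pconj i j \<in> carrier G" using ij by simp
    have "\<pi> (s i [^] (2::nat)) = id"
      using ij pi_mult[of "s i" "s i"] by (simp add: numeral_2_eq_2 pi_s)
    then have "\<pi> (s i [^] (2::nat)) = \<one>\<^bsub>opposite (sym_group n)\<^esub>"
      by (simp add: opposite_def sym_group_def)
    then have "\<pi> a = \<one>\<^bsub>opposite (sym_group n)\<^esub>"
      using ij c h.hom_closed[OF c] by (simp add: pgen_def)
    then show "a \<in> kernel G (opposite (sym_group n)) \<pi>" using ij by (simp add: kernel_def)
  qed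
  with h.subgroup_kernel have "generate G pgens \<subseteq> kernel G (opposite (sym_group n)) \<pi>"
    by (intro generate_subgroup_incl)
  then show ?thesis using assms by (auto simp: kernel_def opposite_def sym_group_def)
qed

lemma pi_fixes:
  assumes "m \<le> n" "x \<in> generate G (s ` {1..<m})" "m < j"
  shows "\<pi> x j = j"
  using assms(2)
proof (induction rule: generate.induct)
  case (incl h)
  then show ?case using assms by (auto simp: pi_s transpose_def)
next
  case (inv h)
  then have h: "h \<in> carrier G" "\<pi> h j = j" using assms by (auto simp: pi_s transpose_def)
  have "\<pi> (inv h) (\<pi> h j) = \<pi> (h \<otimes> inv h) j"
    using h by (simp only: pi_mult inv_closed comp_apply)
  with h show ?case by simp
next
  case (eng h1 h2)
  then have "h1 \<in> carrier G" "h2 \<in> carrier G"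
    using assms(1) subgroup.subset[OF subgroup_generate_s[of m]] by auto
  with eng show ?case by (simp add: pi_mult)
qed simp

text \<open>The leftmost letter acts first, so the point \<open>m\<close> is lowered to
  \<open>m - 1\<close> by \<open>s (m - 1)\<close>, and so on until \<open>s (i + 1)\<close> takes
  it to \<open>i + 1\<close>.\<close>

lemma pi_pconj: "i < m \<Longrightarrow> m \<le> n \<Longrightarrow> \<pi> (pconj i m) m = Suc i"
proof (induction m)
  case (Suc m)
  then show ?case by (cases "i = m") (auto simp: pconj_Suc pi_mult pi_s)
qed simp

lemma kernel_pi_subset_pure:
  assumes "m \<le> n" "x \<in> generate G (s ` {1..<m})" "\<pi> x = id"
  shows "x \<in> generate G pgens"
  using assms
proof (induction m arbitrary: x)
  case 0
  then show ?case by (simp add: generate_empty generate.one)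
next
  case (Suc m)
  obtain h v i where h: "h \<in> generate G pgens" and v: "v \<in> generate G (s ` {1..<m})"
    and i: "i \<le> m" and x: "x = h \<otimes> v \<otimes> pconj i (Suc m)"
    using generate_subset_coset_forms[of m x] Suc.prems by (auto simp: coset_forms_def)
  have c: "v \<in> carrier G" "pconj i (Suc m) \<in> carrier G" "h \<in> carrier G"
    using v h i Suc.prems subgroup.subset[OF subgroup_generate_s[of m]]
      subgroup.subset[OF subgroup_pure] by auto
  have *: "\<pi> (pconj i (Suc m)) \<circ> \<pi> v = id"
    using Suc.prems(3) c pi_pure[OF h] by (simp add: x pi_mult fun_eq_iff)
  \<comment> \<open>The point \<open>Suc m\<close> detects the tail: \<open>v\<close> fixes it and
    the tail sends it to \<open>Suc i\<close>, so \<open>i = m\<close>. Then the tail is empty and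
    \<open>v\<close> itself has trivial permutation.\<close>
  then have "\<pi> (pconj i (Suc m)) (\<pi> v (Suc m)) = Suc m" by (metis comp_apply id_apply)
  then have im: "i = m"
    using pi_fixes[of m v "Suc m"] pi_pconj[of i "Suc m"] v i Suc.prems(1) by simp
  have "v \<in> generate G pgens" by (rule Suc.IH[OF _ v]) (use * im Suc.prems in simp_all)
  then show ?case using x c h im by (simp add: generate.eng)
qed

end

end

section \<open>The semilinear maps\<close>

text \<open>A finitely supported map is the sum of its singletons. Identities that are additive in a
  polynomial, such as \<open>perm_vars_mult\<close> and \<open>abel_single_mult\<close>, thereby
  reduce to monomials.\<close>

lemma poly_mapping_add_induct [case_names zero single add]:
  assumes "P 0" "\<And>k c. P (Poly_Mapping.single k c)" "\<And>p q. P p \<Longrightarrow> P q \<Longrightarrow> P (p + q)"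
  shows "P (p :: 'a \<Rightarrow>\<^sub>0 'b::comm_monoid_add)"
proof -
  let ?f = "\<lambda>k. Poly_Mapping.single k (Poly_Mapping.lookup p k)"
  have "P (\<Sum>k\<in>A. ?f k)" for A
    by (induction A rule: infinite_finite_induct) (auto intro: assms)
  moreover have "p = (\<Sum>k\<in>Poly_Mapping.keys p. ?f k)"
    by (rule poly_mapping_eqI)
      (auto simp: lookup_sum lookup_single when_def in_keys_iff sum.delta cong: if_cong)
  ultimately show ?thesis by metis
qed

section \<open>Permuting the variables of a Laurent polynomial\<close>

lemma lookup_map_key: "inj f \<Longrightarrow> Poly_Mapping.lookup (Poly_Mapping.map_key f p) k = Poly_Mapping.lookup p (f k)"
  by (simp add: map_key.rep_eq)

lemma map_key_inverse:
  assumes "bij f"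
  shows "Poly_Mapping.map_key f (Poly_Mapping.map_key (inv' f) p) = p"
    "Poly_Mapping.map_key (inv' f) (Poly_Mapping.map_key f p) = p"
  using assms by (auto intro!: poly_mapping_eqI
      simp: lookup_map_key bij_is_inj bij_imp_bij_inv bij_is_surj surj_f_inv_f)

lemma inj_map_key: "bij (f :: 'a \<Rightarrow> 'a) \<Longrightarrow> inj (Poly_Mapping.map_key f)"
  by (rule inj_on_inverseI[where g = "Poly_Mapping.map_key (inv' f)"]) (rule map_key_inverse(2))

text \<open>Both uses of \<open>map_key\<close> are precompositions, one on exponents and one on
  coefficients. Their contravariance cancels: the variable with index \<open>k\<close> goes to the
  one with index \<open>\<tau> k\<close>, and \<open>perm_vars_comp\<close> keeps the order of
  composition.\<close>

definition perm_vars :: "(nat \<Rightarrow> nat) \<Rightarrow> laurent \<Rightarrow> laurent"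
  where "perm_vars \<tau> = Poly_Mapping.map_key (Poly_Mapping.map_key \<tau>)"

lemma swap_vars_eq: "swap_vars j = perm_vars (transpose j (Suc j))"
  by (simp add: swap_vars_def perm_vars_def)

lemma perm_vars_id [simp]: "perm_vars id \<alpha> = \<alpha>" "perm_vars (\<lambda>k. k) \<alpha> = \<alpha>"
proof -
  have "Poly_Mapping.map_key (\<lambda>k. k) = (\<lambda>m. m :: nat \<Rightarrow>\<^sub>0 int)"
    by (rule ext) (rule map_key_id)
  then show "perm_vars (\<lambda>k. k) \<alpha> = \<alpha>" unfolding perm_vars_def by (simp add: map_key_id)
  then show "perm_vars id \<alpha> = \<alpha>" by (simp only: id_def)
qed

lemma perm_vars_comp:
  assumes "bij \<sigma>" "bij \<tau>"
  shows "perm_vars \<sigma> (perm_vars \<tau> \<alpha>) = perm_vars (\<sigma> \<circ> \<tau>) \<alpha>"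
proof -
  have "Poly_Mapping.map_key \<tau> \<circ> Poly_Mapping.map_key \<sigma> =
      (Poly_Mapping.map_key (\<sigma> \<circ> \<tau>) :: (nat \<Rightarrow>\<^sub>0 int) \<Rightarrow> _)"
    using assms by (simp add: fun_eq_iff map_key_compose bij_is_inj)
  then show ?thesis
    using assms by (simp add: perm_vars_def map_key_compose inj_map_key)
qed

lemma perm_vars_single:
  "bij \<tau> \<Longrightarrow> perm_vars \<tau> (Poly_Mapping.single m c) =
    Poly_Mapping.single (Poly_Mapping.map_key (inv' \<tau>) m) c"
  using map_key_single[OF inj_map_key, of \<tau> "Poly_Mapping.map_key (inv' \<tau>) m" c]
  by (simp add: perm_vars_def map_key_inverse)

lemma perm_vars_var_pow [simp]: "bij \<tau> \<Longrightarrow> perm_vars \<tau> (var_pow k e) = var_pow (\<tau> k) e"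
  using map_key_single[of "inv' \<tau>" "\<tau> k" e]
  by (simp add: perm_vars_single bij_imp_bij_inv bij_is_inj)

lemma perm_vars_zero [simp]: "bij \<tau> \<Longrightarrow> perm_vars \<tau> 0 = 0"
  and perm_vars_one [simp]: "bij \<tau> \<Longrightarrow> perm_vars \<tau> 1 = 1"
  and perm_vars_add [simp]: "bij \<tau> \<Longrightarrow> perm_vars \<tau> (\<alpha> + \<beta>) = perm_vars \<tau> \<alpha> + perm_vars \<tau> \<beta>"
  by (simp_all add: perm_vars_def inj_map_key map_key_plus)
    (use perm_vars_single[of \<tau> 0 1] in
      \<open>simp add: perm_vars_def bij_imp_bij_inv bij_is_inj\<close>)

lemma perm_vars_uminus [simp]: "bij \<tau> \<Longrightarrow> perm_vars \<tau> (- \<alpha>) = - perm_vars \<tau> \<alpha>"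
  by (metis add.right_inverse add_eq_0_iff perm_vars_add perm_vars_zero)

lemma perm_vars_diff [simp]: "bij \<tau> \<Longrightarrow> perm_vars \<tau> (\<alpha> - \<beta>) = perm_vars \<tau> \<alpha> - perm_vars \<tau> \<beta>"
  by (simp add: perm_vars_add[of \<tau> \<alpha> "- \<beta>", simplified])

lemma perm_vars_mult [simp]:
  assumes "bij \<tau>"
  shows "perm_vars \<tau> (\<alpha> * \<beta>) = perm_vars \<tau> \<alpha> * perm_vars \<tau> \<beta>"
proof (induction \<alpha> rule: poly_mapping_add_induct)
  case (single m c)
  show ?case
  proof (induction \<beta> rule: poly_mapping_add_induct)
    case (single k d)
    then show ?case
      using assms by (simp add: mult_single perm_vars_single map_key_plus bij_imp_bij_inv bij_is_inj)
  qed (use assms in \<open>auto simp: algebra_simps\<close>)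
qed (use assms in \<open>auto simp: algebra_simps\<close>)

section \<open>Closure properties of the Laurent ring and the free module\<close>

lemma zero_in_Laurent [simp]: "0 \<in> carrier (Laurent n)"
  by (simp add: Laurent_def)

lemma one_in_Laurent [simp]: "1 \<in> carrier (Laurent n)"
  by (simp add: Laurent_def)

lemma var_pow_in_Laurent [simp]: "k \<in> {1..n} \<Longrightarrow> var_pow k e \<in> carrier (Laurent n)"
  by (simp add: Laurent_def)

lemma add_in_Laurent [simp]:
  "\<alpha> \<in> carrier (Laurent n) \<Longrightarrow> \<beta> \<in> carrier (Laurent n) \<Longrightarrow> \<alpha> + \<beta> \<in> carrier (Laurent n)"
  using keys_add[of \<alpha> \<beta>] by (auto simp: Laurent_def)

lemma uminus_in_Laurent [simp]: "\<alpha> \<in> carrier (Laurent n) \<Longrightarrow> - \<alpha> \<in> carrier (Laurent n)"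
  by (simp add: Laurent_def)

lemma diff_in_Laurent [simp]:
  "\<alpha> \<in> carrier (Laurent n) \<Longrightarrow> \<beta> \<in> carrier (Laurent n) \<Longrightarrow> \<alpha> - \<beta> \<in> carrier (Laurent n)"
  using add_in_Laurent[of \<alpha> n "- \<beta>"] by simp

lemma mult_in_Laurent [simp]:
  assumes "\<alpha> \<in> carrier (Laurent n)" "\<beta> \<in> carrier (Laurent n)"
  shows "\<alpha> * \<beta> \<in> carrier (Laurent n)"
  unfolding Laurent_def
proof (simp, intro ballI)
  fix m assume "m \<in> Poly_Mapping.keys (\<alpha> * \<beta>)"
  then obtain a b where ab: "a \<in> Poly_Mapping.keys \<alpha>" "b \<in> Poly_Mapping.keys \<beta>" "m = a + b"
    using keys_mult[of \<alpha> \<beta>] by blast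
  have "Poly_Mapping.keys m \<subseteq> Poly_Mapping.keys a \<union> Poly_Mapping.keys b"
    unfolding ab(3) by (rule keys_add)
  also have "\<dots> \<subseteq> {1..n}" using assms ab by (simp add: Laurent_def)
  finally show "Poly_Mapping.keys m \<subseteq> {Suc 0..n}" by simp
qed

lemma perm_vars_in_Laurent [simp]:
  assumes "\<tau> permutes {1..n}" "\<alpha> \<in> carrier (Laurent n)"
  shows "perm_vars \<tau> \<alpha> \<in> carrier (Laurent n)"
  unfolding Laurent_def
proof (simp, intro ballI)
  fix m assume "m \<in> Poly_Mapping.keys (perm_vars \<tau> \<alpha>)"
  then have m: "Poly_Mapping.keys (Poly_Mapping.map_key \<tau> m) \<subseteq> {1..n}"
    using assms by (auto simp: perm_vars_def keys_map_key inj_map_key permutes_bij Laurent_def)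
  show "Poly_Mapping.keys m \<subseteq> {Suc 0..n}"
  proof
    fix k assume "k \<in> Poly_Mapping.keys m"
    then have "inv' \<tau> k \<in> Poly_Mapping.keys (Poly_Mapping.map_key \<tau> m)"
      using assms(1) by (simp add: keys_map_key permutes_inj permutes_inverses)
    then have "inv' \<tau> k \<in> {1..n}" using m by blast
    then show "k \<in> {Suc 0..n}"
      using permutes_in_image[OF permutes_inv[OF assms(1)], of k] by simp
  qed
qed

lemma lookup_scale [simp]: "Poly_Mapping.lookup (scale \<alpha> v) k = \<alpha> * Poly_Mapping.lookup v k"
  by (simp add: map.rep_eq when_def)

lemma carrier_Free_mod:
  "v \<in> carrier (Free_mod n) \<longleftrightarrow>
    (\<forall>k. Poly_Mapping.lookup v k \<in> carrier (Laurent n)) \<and>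
    (\<forall>k. k \<notin> {1..n} \<longrightarrow> Poly_Mapping.lookup v k = 0)"
  by (auto simp: Free_mod_def in_keys_iff subset_eq)

lemma add_in_Free_mod [simp]:
  "u \<in> carrier (Free_mod n) \<Longrightarrow> v \<in> carrier (Free_mod n) \<Longrightarrow> u + v \<in> carrier (Free_mod n)"
  by (simp add: carrier_Free_mod lookup_add)

lemma zero_in_Free_mod [simp]: "0 \<in> carrier (Free_mod n)"
  by (simp add: carrier_Free_mod)

lemma uminus_in_Free_mod [simp]: "v \<in> carrier (Free_mod n) \<Longrightarrow> - v \<in> carrier (Free_mod n)"
  by (simp add: carrier_Free_mod)

lemma diff_in_Free_mod [simp]:
  "u \<in> carrier (Free_mod n) \<Longrightarrow> v \<in> carrier (Free_mod n) \<Longrightarrow> u - v \<in> carrier (Free_mod n)"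
  by (simp add: carrier_Free_mod lookup_minus)

lemma scale_in_Free_mod [simp]:
  "\<alpha> \<in> carrier (Laurent n) \<Longrightarrow> v \<in> carrier (Free_mod n) \<Longrightarrow> scale \<alpha> v \<in> carrier (Free_mod n)"
  by (simp add: carrier_Free_mod)

lemma single_in_Free_mod [simp]:
  "k \<in> {1..n} \<Longrightarrow> \<alpha> \<in> carrier (Laurent n) \<Longrightarrow>
    Poly_Mapping.single k \<alpha> \<in> carrier (Free_mod n)"
  by (auto simp: carrier_Free_mod lookup_single when_def)

lemma sum_in_Free_mod [simp]:
  "(\<And>i. i \<in> A \<Longrightarrow> f i \<in> carrier (Free_mod n)) \<Longrightarrow> sum f A \<in> carrier (Free_mod n)"
  by (induction A rule: infinite_finite_induct) auto

lemma add_Free_mod [simp]: "u \<oplus>\<^bsub>Free_mod n\<^esub> v = u + v"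
  and zero_Free_mod [simp]: "\<zero>\<^bsub>Free_mod n\<^esub> = 0"
  by (simp_all add: Free_mod_def)

lemma group_Free_add: "group (Free_add n)"
proof (rule groupI)
  fix x assume "x \<in> carrier (Free_add n)"
  then show "\<exists>y\<in>carrier (Free_add n). y \<otimes>\<^bsub>Free_add n\<^esub> x = \<one>\<^bsub>Free_add n\<^esub>"
    by (intro bexI[of _ "- x"]) auto
qed (auto simp: add.assoc)

section \<open>The semilinear maps in coordinates\<close>

lemma permutes_transpose: "j \<in> {1..<n} \<Longrightarrow> transpose j (Suc j) permutes {1..n}"
  by (intro permutes_swap_id) auto

text \<open>Only the coordinates \<open>j\<close> and \<open>Suc j\<close> mix. Additivity,
  semilinearity, invertibility and the relations of these maps are all verified coordinate by
  coordinate from this formula.\<close>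

lemma lookup_R_map:
  assumes "v \<in> carrier (Free_mod n)" "j \<in> {1..<n}"
  shows "Poly_Mapping.lookup (R_map n j v) m =
    (if m = j then (1 - var (Suc j)) * swap_vars j (Poly_Mapping.lookup v j)
        + swap_vars j (Poly_Mapping.lookup v (Suc j))
     else if m = Suc j then var j * swap_vars j (Poly_Mapping.lookup v j)
     else swap_vars j (Poly_Mapping.lookup v m))"
proof -
  let ?f = "\<lambda>k. swap_vars j (Poly_Mapping.lookup v k) * Poly_Mapping.lookup (R_basis j k) m"
  have "Poly_Mapping.lookup (R_map n j v) m = (\<Sum>k = 1..n. ?f k)"
    using assms by (simp add: R_map_def lookup_sum)
  also have "\<dots> = (\<Sum>k \<in> {1..n} - {j, Suc j}. ?f k) + (\<Sum>k \<in> {j, Suc j}. ?f k)"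
    using assms(2) by (intro sum.subset_diff) auto
  also have "(\<Sum>k \<in> {1..n} - {j, Suc j}. ?f k) =
      (\<Sum>k \<in> {1..n} - {j, Suc j}. if k = m then swap_vars j (Poly_Mapping.lookup v m) else 0)"
    by (rule sum.cong) (auto simp: R_basis_def lookup_single)
  also have "\<dots> = (if m \<in> {1..n} - {j, Suc j} then swap_vars j (Poly_Mapping.lookup v m) else 0)"
    by simp
  also have "\<dots> = (if m \<in> {j, Suc j} then 0 else swap_vars j (Poly_Mapping.lookup v m))"
    using assms(1) by (auto simp: carrier_Free_mod swap_vars_eq)
  also have "(\<Sum>k \<in> {j, Suc j}. ?f k) =
      (if m = j then (1 - var (Suc j)) * swap_vars j (Poly_Mapping.lookup v j)
        + swap_vars j (Poly_Mapping.lookup v (Suc j))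
       else if m = Suc j then var j * swap_vars j (Poly_Mapping.lookup v j) else 0)"
    by (simp add: R_basis_def lookup_single lookup_add mult.commute)
  finally show ?thesis by simp
qed

lemma swap_vars_in_Laurent:
  "j \<in> {1..<n} \<Longrightarrow> \<alpha> \<in> carrier (Laurent n) \<Longrightarrow> swap_vars j \<alpha> \<in> carrier (Laurent n)"
  unfolding swap_vars_eq by (intro perm_vars_in_Laurent permutes_transpose)

lemma R_map_closed:
  assumes "v \<in> carrier (Free_mod n)" "j \<in> {1..<n}"
  shows "R_map n j v \<in> carrier (Free_mod n)"
  using assms swap_vars_in_Laurent[OF assms(2)] unfolding carrier_Free_mod[of "R_map n j v"]
  by (auto simp: lookup_R_map carrier_Free_mod) (auto simp: swap_vars_eq)

lemma R_map_add:
  assumes "u \<in> carrier (Free_mod n)" "v \<in> carrier (Free_mod n)" "j \<in> {1..<n}"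
  shows "R_map n j (u + v) = R_map n j u + R_map n j v"
  by (rule poly_mapping_eqI)
    (use assms in \<open>simp add: lookup_R_map lookup_add swap_vars_eq algebra_simps\<close>)

lemma R_map_scale:
  assumes "\<alpha> \<in> carrier (Laurent n)" "v \<in> carrier (Free_mod n)" "j \<in> {1..<n}"
  shows "R_map n j (scale \<alpha> v) = scale (swap_vars j \<alpha>) (R_map n j v)"
  by (rule poly_mapping_eqI)
    (use assms in \<open>simp add: lookup_R_map swap_vars_eq algebra_simps\<close>)

lemma var_pow_mult_inverse [simp]:
  "var_pow k e * var_pow k (- e) = 1" "var_pow k (- e) * var_pow k e = 1"
  by (simp_all add: mult_single flip: single_add)

lemma swap_vars_swap_vars [simp]: "swap_vars j (swap_vars j \<alpha>) = \<alpha>"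
  by (simp add: swap_vars_eq perm_vars_comp)

lemma swap_vars_hom [simp]:
  "swap_vars j (\<alpha> + \<beta>) = swap_vars j \<alpha> + swap_vars j \<beta>"
  "swap_vars j (\<alpha> - \<beta>) = swap_vars j \<alpha> - swap_vars j \<beta>"
  "swap_vars j (\<alpha> * \<beta>) = swap_vars j \<alpha> * swap_vars j \<beta>"
  "swap_vars j 1 = 1" "swap_vars j (var_pow k e) = var_pow (transpose j (Suc j) k) e"
  by (simp_all add: swap_vars_eq)

lemma var_pow_cancel [simp]:
  "var k * (var_pow k (- 1) * \<alpha>) = \<alpha>" "var_pow k (- 1) * (var k * \<alpha>) = \<alpha>"
  by (simp_all flip: mult.assoc)

lemma R_map_in_Aut:
  assumes j: "j \<in> {1..<n}"
  shows "R_map n j \<in> carrier (Aut (Free_add n))"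
proof -
  \<comment> \<open>These are the coordinates of the preimage of \<open>w\<close>. Coordinate
    \<open>Suc j\<close> of the image is a unit times the swapped coordinate \<open>j\<close>, which
    is thus recovered first; substituting it into coordinate \<open>j\<close> of the image yields
    the other.\<close>
  define c where "c w k = (if k = j then var_pow (Suc j) (- 1) * swap_vars j (Poly_Mapping.lookup w (Suc j))
    else if k = Suc j then swap_vars j (Poly_Mapping.lookup w j)
      - (1 - var j) * (var_pow (Suc j) (- 1) * swap_vars j (Poly_Mapping.lookup w (Suc j)))
    else swap_vars j (Poly_Mapping.lookup w k))" for w :: "nat \<Rightarrow>\<^sub>0 laurent" and k
  define S where "S w = (\<Sum>k = 1..n. Poly_Mapping.single k (c w k))" for w
  have c0: "c w k = 0" if "w \<in> carrier (Free_mod n)" "k \<notin> {1..n}" for w k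
    using that j by (auto simp: c_def carrier_Free_mod swap_vars_eq)
  have S: "Poly_Mapping.lookup (S w) k = c w k" if "w \<in> carrier (Free_mod n)" for w k
    using c0[OF that, of k] by (auto simp: S_def lookup_sum lookup_single when_def)
  have S_closed: "S w \<in> carrier (Free_mod n)" if w: "w \<in> carrier (Free_mod n)" for w
    unfolding carrier_Free_mod S[OF w]
  proof (intro conjI allI impI)
    show "c w k \<in> carrier (Laurent n)" for k
      using w j swap_vars_in_Laurent[OF j] by (auto simp: c_def carrier_Free_mod)
  qed (rule c0[OF w])
  show ?thesis
  proof (rule carrier_AutI)
    show "R_map n j \<in> hom (Free_add n) (Free_add n)"
      using j by (intro homI) (auto simp: R_map_closed R_map_add)
    show "R_map n j \<in> extensional (carrier (Free_add n))"
      by (simp add: R_map_def)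
    fix w assume "w \<in> carrier (Free_add n)"
    then have w: "w \<in> carrier (Free_mod n)" by simp
    show "S w \<in> carrier (Free_add n)" using S_closed[OF w] by simp
    show "R_map n j (S w) = w"
    proof (rule poly_mapping_eqI)
      fix m
      show "Poly_Mapping.lookup (R_map n j (S w)) m = Poly_Mapping.lookup w m"
        using j w S_closed[OF w] by (simp add: lookup_R_map S c_def)
    qed
    show "S (R_map n j w) = w"
    proof (rule poly_mapping_eqI)
      fix m
      show "Poly_Mapping.lookup (S (R_map n j w)) m = Poly_Mapping.lookup w m"
        using j w R_map_closed[OF w j] by (simp add: lookup_R_map S c_def)
    qed
  qed
qed

section \<open>Braid relations for transpositions and for the semilinear maps\<close>

lemma transpose_braid:
  "transpose i (Suc i) \<circ> transpose (Suc i) (Suc (Suc i)) \<circ> transpose i (Suc i) =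
    transpose (Suc i) (Suc (Suc i)) \<circ> transpose i (Suc i) \<circ> transpose (Suc i) (Suc (Suc i))"
  by (auto simp: fun_eq_iff transpose_def)

lemma transpose_far_comm:
  "i + 2 \<le> j \<Longrightarrow>
    transpose i (Suc i) \<circ> transpose j (Suc j) = transpose j (Suc j) \<circ> transpose i (Suc i)"
  by (auto simp: fun_eq_iff transpose_def)

lemma swap_vars_braid:
  "swap_vars i (swap_vars (Suc i) (swap_vars i \<alpha>)) =
    swap_vars (Suc i) (swap_vars i (swap_vars (Suc i) \<alpha>))"
  using transpose_braid[of i] by (simp add: swap_vars_eq perm_vars_comp bij_comp o_assoc)

lemma swap_vars_far_comm:
  "i + 2 \<le> j \<Longrightarrow> swap_vars i (swap_vars j \<alpha>) = swap_vars j (swap_vars i \<alpha>)"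
  using transpose_far_comm[of i j] by (simp add: swap_vars_eq perm_vars_comp)

lemma R_map_braid:
  assumes i: "1 \<le> i" "i + 2 \<le> n" and v: "v \<in> carrier (Free_mod n)"
  shows "R_map n i (R_map n (Suc i) (R_map n i v)) =
    R_map n (Suc i) (R_map n i (R_map n (Suc i) v))"
proof (rule poly_mapping_eqI)
  fix m
  have ij: "i \<in> {1..<n}" "Suc i \<in> {1..<n}" using i by auto
  show "Poly_Mapping.lookup (R_map n i (R_map n (Suc i) (R_map n i v))) m =
    Poly_Mapping.lookup (R_map n (Suc i) (R_map n i (R_map n (Suc i) v))) m"
    using ij v
    by (simp add: lookup_R_map[OF _ ij(1)] lookup_R_map[OF _ ij(2)] R_map_closed swap_vars_braid algebra_simps)
qed

lemma R_map_far_comm: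
  assumes "i \<in> {1..<n}" "j \<in> {1..<n}" "i + 2 \<le> j" "v \<in> carrier (Free_mod n)"
  shows "R_map n i (R_map n j v) = R_map n j (R_map n i v)"
proof (rule poly_mapping_eqI)
  fix m
  show "Poly_Mapping.lookup (R_map n i (R_map n j v)) m = Poly_Mapping.lookup (R_map n j (R_map n i v)) m"
    using assms swap_vars_far_comm[OF assms(3)]
    by (simp add: lookup_R_map R_map_closed transpose_def)
qed

text \<open>Products in \<open>Aut H\<close> apply the left factor first. The braid relation is
  palindromic and keeps its shape when evaluated at a point, whereas the commutation hypothesis
  appears with the order of \<open>s i\<close> and \<open>s j\<close> reversed.\<close>

lemma braid_group_like_AutI:
  assumes "group H" and s: "\<And>i. i \<in> {1..<n} \<Longrightarrow> s i \<in> carrier (Aut H)"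
    and "\<And>i x. 1 \<le> i \<Longrightarrow> i + 2 \<le> n \<Longrightarrow> x \<in> carrier H \<Longrightarrow>
      s i (s (Suc i) (s i x)) = s (Suc i) (s i (s (Suc i) x))"
    and "\<And>i j x. i \<in> {1..<n} \<Longrightarrow> j \<in> {1..<n} \<Longrightarrow> i + 2 \<le> j \<Longrightarrow> x \<in> carrier H \<Longrightarrow>
      s j (s i x) = s i (s j x)"
  shows "braid_group_like (Aut H) s n"
proof -
  interpret A: group "Aut H" by (rule group_Aut) fact
  show ?thesis
  proof
    fix i assume i: "1 \<le> i" "i + 2 \<le> n"
    then have c: "s i \<in> carrier (Aut H)" "s (Suc i) \<in> carrier (Aut H)" using s by auto
    with i show "s i \<otimes>\<^bsub>Aut H\<^esub> s (Suc i) \<otimes>\<^bsub>Aut H\<^esub> s i =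
      s (Suc i) \<otimes>\<^bsub>Aut H\<^esub> s i \<otimes>\<^bsub>Aut H\<^esub> s (Suc i)"
      by (intro Aut_eqI[where G = H] A.m_closed) (simp_all add: mult_Aut_apply assms(3))
  next
    fix i j assume "i \<in> {1..<n}" "j \<in> {1..<n}" "i + 2 \<le> j"
    then show "s i \<otimes>\<^bsub>Aut H\<^esub> s j = s j \<otimes>\<^bsub>Aut H\<^esub> s i"
      using s by (intro Aut_eqI[where G = H] A.m_closed) (simp_all add: mult_Aut_apply assms(4))
  qed (rule s)
qed

lemma braid_group_like_R_map: "braid_group_like (Aut (Free_add n)) (R_map n) n"
  by (intro braid_group_like_AutI group_Free_add R_map_in_Aut)
    (auto simp: R_map_braid intro!: R_map_far_comm[symmetric])

lemma braid_group_like_transpose: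
  "braid_group_like (opposite (sym_group n)) (\<lambda>i. transpose i (i + 1)) n"
proof -
  interpret group "opposite (sym_group n)" by (intro group_opposite sym_group_is_group)
  show ?thesis
  proof
    fix i assume "i \<in> {1..<n}"
    then show "transpose i (i + 1) \<in> carrier (opposite (sym_group n))"
      using permutes_transpose[of i n] by (simp add: opposite_def sym_group_def)
  next
    fix i j :: nat assume "i + 2 \<le> j"
    then show "transpose i (i + 1) \<otimes>\<^bsub>opposite (sym_group n)\<^esub> transpose j (j + 1) =
      transpose j (j + 1) \<otimes>\<^bsub>opposite (sym_group n)\<^esub> transpose i (i + 1)"
      using transpose_far_comm[of i j] by (simp add: opposite_def sym_group_def)
  qed (use transpose_braid in \<open>auto simp: opposite_def sym_group_def o_assoc\<close>)
qed

section \<open>The Artin representation\<close>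

text \<open>The inverse is written with \<open>+ -\<close>, and \<open>add_uminus_conv_diff\<close>
  is kept out of the simplifications below, so that words in the free group are normalised by
  associativity and cancellation.\<close>

definition artin_image :: "nat \<Rightarrow> nat \<Rightarrow> nat free_group"
  where "artin_image j k = (if k = j then gen j + gen (Suc j) + - gen j
    else if k = Suc j then gen j else gen k)"

lemma artin_gen_eq: "artin_gen n j = (\<lambda>w \<in> carrier (Free {1..n}). free_lift (Free {1..n}) (artin_image j) w)"
proof -
  have "artin_image j = (\<lambda>k. if k = j then gen j + gen (j + 1) - gen j
      else if k = j + 1 then gen j else gen k)"
    by (auto simp: artin_image_def)
  then show ?thesis by (simp only: artin_gen_def)
qed

lemma artin_image_closed: "j \<in> {1..<n} \<Longrightarrow> k \<in> {1..n} \<Longrightarrow> artin_image j k \<in> carrier (Free {1..n})"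
  by (simp add: artin_image_def del: add_uminus_conv_diff)

lemma artin_gen_hom:
  assumes "j \<in> {1..<n}"
  shows "artin_gen n j \<in> hom (Free {1..n}) (Free {1..n})"
proof -
  have "free_lift (Free {1..n}) (artin_image j) \<in> hom (Free {1..n}) (Free {1..n})"
    by (rule group.free_lift_hom[OF group_Free artin_image_closed[OF assms]])
  then show ?thesis by (auto simp: hom_def artin_gen_eq)
qed

lemma artin_gen_closed:
  "j \<in> {1..<n} \<Longrightarrow> w \<in> carrier (Free {1..n}) \<Longrightarrow> artin_gen n j w \<in> carrier (Free {1..n})"
  using artin_gen_hom by (auto simp: hom_def)

lemma artin_gen_add:
  "j \<in> {1..<n} \<Longrightarrow> u \<in> carrier (Free {1..n}) \<Longrightarrow> v \<in> carrier (Free {1..n}) \<Longrightarrow>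
    artin_gen n j (u + v) = artin_gen n j u + artin_gen n j v"
  using hom_mult[OF artin_gen_hom] by simp

lemma artin_gen_zero: "j \<in> {1..<n} \<Longrightarrow> artin_gen n j 0 = 0"
  using hom_one[OF artin_gen_hom group_Free group_Free] by simp

lemma artin_gen_uminus:
  "j \<in> {1..<n} \<Longrightarrow> u \<in> carrier (Free {1..n}) \<Longrightarrow> artin_gen n j (- u) = - artin_gen n j u"
  using artin_gen_add[of j n "- u" u] artin_gen_zero[of j n]
  by (metis add.left_inverse minus_unique neg_equal_iff_equal uminus_in_Free minus_minus)

lemma artin_gen_gen: "j \<in> {1..<n} \<Longrightarrow> k \<in> {1..n} \<Longrightarrow> artin_gen n j (gen k) = artin_image j k"
  using artin_image_closed[of j n k] by (simp add: artin_gen_eq group.free_lift_gen)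

lemma artin_gen_in_Aut:
  assumes j: "j \<in> {1..<n}"
  shows "artin_gen n j \<in> carrier (Aut (Free {1..n}))"
proof -
  let ?F = "Free {1..n}"
  \<comment> \<open>The images under the inverse automorphism: undoing the conjugation sends the
    second generator to its conjugate by its own inverse applied to the first, that is
    \<open>x_{j+1}\<close> to \<open>x_{j+1}^-1 x_j x_{j+1}\<close>.\<close>
  define f where "f k = (if k = j then gen (Suc j)
    else if k = Suc j then - gen (Suc j) + (gen j + gen (Suc j)) else gen k)" for k
  define h where "h = free_lift ?F f"
  have f: "f k \<in> carrier ?F" if "k \<in> {1..n}" for k
    using that j by (simp add: f_def)
  have h: "h \<in> hom ?F ?F" unfolding h_def by (intro group.free_lift_hom group_Free f)
  have h_gen: "h (gen k) = f k" if "k \<in> {1..n}" for k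
    unfolding h_def using f[OF that] by (simp add: group.free_lift_gen)
  have h_closed: "h w \<in> carrier ?F" if "w \<in> carrier ?F" for w
    using h that by (auto simp: hom_def)
  have h_add: "h (u + v) = h u + h v" if "u \<in> carrier ?F" "v \<in> carrier ?F" for u v
    using hom_mult[OF h that] by simp
  have h_uminus: "h (- u) = - h u" if "u \<in> carrier ?F" for u
  proof -
    have "h (- u) + h u = 0"
      using that h_add[of "- u" u] hom_one[OF h group_Free group_Free] by simp
    then show ?thesis by (simp add: eq_neg_iff_add_eq_0)
  qed
  have id: "(\<lambda>x. x) \<in> hom ?F ?F" by (simp add: hom_def)
  show ?thesis
  proof (rule carrier_AutI[OF artin_gen_hom[OF j]])
    show "artin_gen n j \<in> extensional (carrier ?F)" by (simp add: artin_gen_eq)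
    fix w assume w: "w \<in> carrier ?F"
    show "h w \<in> carrier ?F" by (rule h_closed[OF w])
    have "(artin_gen n j \<circ> h) w = w"
    proof (rule group.hom_Free_eqI[OF group_Free _ id _ w])
      show "artin_gen n j \<circ> h \<in> hom ?F ?F" using h artin_gen_hom[OF j] by (rule hom_compose)
      fix k assume "k \<in> {1..n}"
      then show "(artin_gen n j \<circ> h) (gen k) = gen k"
        using j by (simp add: h_gen f_def artin_gen_gen artin_gen_add artin_gen_uminus
            artin_image_def add.assoc del: add_uminus_conv_diff)
    qed
    then show "artin_gen n j (h w) = w" by simp
    have "(h \<circ> artin_gen n j) w = w"
    proof (rule group.hom_Free_eqI[OF group_Free _ id _ w])
      show "h \<circ> artin_gen n j \<in> hom ?F ?F" using artin_gen_hom[OF j] h by (rule hom_compose)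
      fix k assume "k \<in> {1..n}"
      then show "(h \<circ> artin_gen n j) (gen k) = gen k"
        using j by (simp add: h_gen f_def artin_gen_gen h_add h_uminus
            artin_image_def add.assoc del: add_uminus_conv_diff)
    qed
    then show "h (artin_gen n j w) = w" by simp
  qed
qed

text \<open>Both sides of each relation are endomorphisms of a free group, so it suffices to compare
  them on the generators.\<close>

lemma braid_group_like_artin_gen: "braid_group_like (Aut (Free {1..n})) (artin_gen n) n"
proof (intro braid_group_like_AutI group_Free artin_gen_in_Aut)
  fix i w assume i: "1 \<le> i" "i + 2 \<le> n" and w: "w \<in> carrier (Free {1..n})"
  let ?f = "artin_gen n i" and ?g = "artin_gen n (Suc i)"
  have ij: "i \<in> {1..<n}" "Suc i \<in> {1..<n}" using i by auto
  have "(?f \<circ> (?g \<circ> ?f)) w = (?g \<circ> (?f \<circ> ?g)) w"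
  proof (rule group.hom_Free_eqI[OF group_Free _ _ _ w])
    show "?f \<circ> (?g \<circ> ?f) \<in> hom (Free {1..n}) (Free {1..n})"
      "?g \<circ> (?f \<circ> ?g) \<in> hom (Free {1..n}) (Free {1..n})"
      using ij artin_gen_hom by (meson hom_compose)+
    fix k assume "k \<in> {1..n}"
    then show "(?f \<circ> (?g \<circ> ?f)) (gen k) = (?g \<circ> (?f \<circ> ?g)) (gen k)"
      using i ij by (simp add: artin_gen_gen artin_gen_add artin_gen_uminus artin_image_def
          add.assoc minus_add del: add_uminus_conv_diff)
  qed
  then show "?f (?g (?f w)) = ?g (?f (?g w))" by simp
next
  fix i j w assume ij: "i \<in> {1..<n}" "j \<in> {1..<n}" "i + 2 \<le> j" and w: "w \<in> carrier (Free {1..n})"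
  let ?f = "artin_gen n i" and ?g = "artin_gen n j"
  have "(?g \<circ> ?f) w = (?f \<circ> ?g) w"
  proof (rule group.hom_Free_eqI[OF group_Free _ _ _ w])
    show "?g \<circ> ?f \<in> hom (Free {1..n}) (Free {1..n})" "?f \<circ> ?g \<in> hom (Free {1..n}) (Free {1..n})"
      using ij artin_gen_hom by (meson hom_compose)+
    fix k assume "k \<in> {1..n}"
    then show "(?g \<circ> ?f) (gen k) = (?f \<circ> ?g) (gen k)"
      using ij by (simp add: artin_gen_gen artin_gen_add artin_gen_uminus artin_image_def
          add.assoc minus_add del: add_uminus_conv_diff)
  qed
  then show "?g (?f w) = ?f (?g w)" by simp
qed

section \<open>Fox derivatives\<close>

text \<open>The factor of \<open>abel\<close> that belongs to a single group element; on group
  elements the abelianisation is multiplicative (\<open>ab_add\<close>), and \<open>abel\<close> is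
  its linear extension.\<close>

definition ab :: "nat free_group \<Rightarrow> laurent"
  where "ab w = (\<Prod>(i, b) \<leftarrow> word_of w. var_pow i (if b then 1 else - 1))"

lemma ab_zero [simp]: "ab 0 = 1"
  by (simp add: ab_def zero_free_group.rep_eq)

lemma ab_gen [simp]: "ab (gen i) = var i"
  by (simp add: ab_def gen.rep_eq)

lemma ab_minus_gen [simp]: "ab (- gen i) = var_pow i (- 1)"
  by (simp add: ab_def gen.rep_eq uminus_free_group.rep_eq)

lemma ab_add [simp]: "ab (u + v) = ab u * ab v"
proof -
  let ?g = "\<lambda>(i, b) y. var_pow i (if b then 1 else - 1) * y"
  have prod: "(\<Prod>(i, b) \<leftarrow> w. var_pow i (if b then 1 else - 1)) * z = foldr ?g w z" for w z
    by (induction w) (auto simp: mult.assoc)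
  have "ab (u + v) = foldr ?g (foldr cons_red (word_of u) (word_of v)) 1"
    unfolding prod[symmetric] by (simp add: ab_def plus_free_group.rep_eq)
  also have "\<dots> = foldr ?g (word_of u) (foldr ?g (word_of v) 1)"
    by (rule foldr_foldr_cons_red[where S = UNIV and Y = UNIV]) auto
  also have "\<dots> = ab u * ab v"
    unfolding prod[symmetric] by (simp add: ab_def)
  finally show ?thesis .
qed

lemma abel_eq: "abel \<xi> = (\<Sum>w \<in> Poly_Mapping.keys \<xi>. of_int (Poly_Mapping.lookup \<xi> w) * ab w)"
  by (simp add: abel_def ab_def)

lemma abel_add: "abel (\<xi> + \<zeta>) = abel \<xi> + abel \<zeta>"
  unfolding abel_eq by (rule setsum_keys_plus_distrib) (simp_all add: algebra_simps)

lemma abel_single: "abel (Poly_Mapping.single w c) = of_int c * ab w"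
  by (cases "c = 0") (simp_all add: abel_eq)

lemma abel_zero [simp]: "abel 0 = 0"
  by (simp add: abel_eq)

lemma abel_one [simp]: "abel 1 = 1"
  using abel_single[of 0 1] by simp

lemma abel_diff: "abel (\<xi> - \<zeta>) = abel \<xi> - abel \<zeta>"
  using abel_add[of "\<xi> - \<zeta>" \<zeta>] by simp

lemma abel_single_mult: "abel (Poly_Mapping.single g 1 * \<xi>) = ab g * abel \<xi>"
  by (induction \<xi> rule: poly_mapping_add_induct)
    (simp_all add: mult_single abel_single distrib_left abel_add mult_ac)

text \<open>After abelianisation a letter acts on the derivative of the remaining word by an affine
  map, and the opposite letter acts by the inverse map. Hence \<open>foldr_foldr_cons_red\<close>
  takes care of the cancellations in the reduced product.\<close>

lemma abel_fox_add: "abel (fox s (u + v)) = abel (fox s u) + ab u * abel (fox s v)"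
proof -
  define d :: "nat \<Rightarrow> laurent" where "d i = (if i = s then 1 else 0)" for i
  define g where "g = (\<lambda>(i, b) y. if b then d i + var i * y else var_pow i (- 1) * (y - d i))"
  have fox: "abel (fox_word s w) = foldr g w 0" for w
  proof (induction w)
    case (Cons a w)
    obtain i b where "a = (i, b)" by (cases a)
    with Cons show ?case
      by (cases b) (simp_all add: g_def d_def abel_add abel_diff abel_single_mult)
  qed simp
  \<comment> \<open>A composite of affine maps is its value at 0 plus its linear part, and the
    linear part attached to a word is its abelianisation.\<close>
  have affine: "foldr g w z = foldr g w 0 + (\<Prod>(i, b) \<leftarrow> w. var_pow i (if b then 1 else - 1)) * z" for w z
    by (induction w) (auto simp: g_def algebra_simps)
  have "abel (fox s (u + v)) = foldr g (foldr cons_red (word_of u) (word_of v)) 0"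
    by (simp add: fox_def fox plus_free_group.rep_eq)
  also have "\<dots> = foldr g (word_of u) (foldr g (word_of v) 0)"
    by (rule foldr_foldr_cons_red[where S = UNIV and Y = UNIV]) (auto simp: g_def)
  also have "\<dots> = abel (fox s u) + ab u * abel (fox s v)"
    by (subst affine) (simp add: fox_def fox ab_def)
  finally show ?thesis .
qed

text \<open>The crossed homomorphism \<open>D\<close>, with \<open>fox_vector_add\<close> as its
  cocycle rule. Applied to \<open>artin n b (gen r)\<close> it packs row \<open>r\<close> of
  \<open>gassner_matrix n b\<close> into one vector.\<close>

definition fox_vector :: "nat \<Rightarrow> nat free_group \<Rightarrow> (nat \<Rightarrow>\<^sub>0 laurent)"
  where "fox_vector n w = (\<Sum>s = 1..n. scale (abel (fox s w)) (basis s))"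

lemma lookup_fox_vector:
  "Poly_Mapping.lookup (fox_vector n w) k = (if k \<in> {1..n} then abel (fox k w) else 0)"
  by (simp add: fox_vector_def lookup_sum lookup_single when_def if_distrib cong: if_cong)

lemma fox_vector_add: "fox_vector n (u + v) = fox_vector n u + scale (ab u) (fox_vector n v)"
  by (rule poly_mapping_eqI) (simp add: lookup_fox_vector abel_fox_add lookup_add)

lemma fox_vector_zero [simp]: "fox_vector n 0 = 0"
  by (rule poly_mapping_eqI) (simp add: lookup_fox_vector fox_def zero_free_group.rep_eq)

lemma fox_vector_gen: "k \<in> {1..n} \<Longrightarrow> fox_vector n (gen k) = basis k"
  by (rule poly_mapping_eqI)
    (auto simp: lookup_fox_vector fox_def gen.rep_eq lookup_single when_def)

lemma fox_vector_uminus: "fox_vector n (- u) = - scale (ab (- u)) (fox_vector n u)"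
  using fox_vector_add[of n "- u" u] by (simp add: eq_neg_iff_add_eq_0)

lemma ab_closed: "w \<in> carrier (Free {1..n}) \<Longrightarrow> ab w \<in> carrier (Laurent n)"
  by (induction rule: Free_induct) simp_all

lemma fox_vector_closed: "w \<in> carrier (Free {1..n}) \<Longrightarrow> fox_vector n w \<in> carrier (Free_mod n)"
  by (induction rule: Free_induct)
    (simp_all add: fox_vector_add fox_vector_uminus fox_vector_gen)

text \<open>Conjugation disappears in the abelianisation, so on variables the Artin generator only
  exchanges two indices. This is the source of the twist in the semilinear maps.\<close>

lemma ab_artin_gen:
  assumes "j \<in> {1..<n}" "w \<in> carrier (Free {1..n})"
  shows "ab (artin_gen n j w) = swap_vars j (ab w)"
proof -
  have gen: "ab (artin_image j k) = var (transpose j (Suc j) k)" for k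
    by (simp add: artin_image_def transpose_def mult_ac del: add_uminus_conv_diff)
  have minus_gen: "ab (- artin_image j k) = var_pow (transpose j (Suc j) k) (- 1)" for k
    by (simp add: artin_image_def transpose_def minus_add mult_ac del: add_uminus_conv_diff)
  show ?thesis
    using assms(2,1)
    by (induction rule: Free_induct)
      (simp_all add: artin_gen_zero artin_gen_add artin_gen_uminus artin_gen_gen gen minus_gen)
qed

lemma R_map_zero: "j \<in> {1..<n} \<Longrightarrow> R_map n j 0 = 0"
  using R_map_add[of 0 n 0 j] by simp

lemma R_map_uminus:
  "x \<in> carrier (Free_mod n) \<Longrightarrow> j \<in> {1..<n} \<Longrightarrow> R_map n j (- x) = - R_map n j x"
  using R_map_add[of "- x" n x j] R_map_zero[of j n] by (simp add: eq_neg_iff_add_eq_0)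

text \<open>The essential case is \<open>k = j\<close>: the cocycle rule gives
  \<open>D (x_j x_{j+1} x_j^-1) = e_j + t_j e_{j+1} - t_{j+1} e_j\<close>, the prescribed image of
  \<open>e_j\<close>.\<close>

lemma R_map_fox_vector_gen:
  assumes "j \<in> {1..<n}" "k \<in> {1..n}"
  shows "R_map n j (fox_vector n (gen k)) = fox_vector n (artin_gen n j (gen k))"
  by (rule poly_mapping_eqI)
    (use assms in \<open>auto simp: lookup_R_map artin_gen_gen artin_image_def fox_vector_add
      fox_vector_uminus fox_vector_gen lookup_add lookup_single when_def swap_vars_eq algebra_simps
      simp del: add_uminus_conv_diff\<close>)

text \<open>Expanding both sides by the cocycle rule leaves the scalars
  \<open>swap_vars j (ab u)\<close> and \<open>ab (artin_gen n j u)\<close> to compare, and these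
  agree by \<open>ab_artin_gen\<close>.\<close>

lemma R_map_fox_vector_add:
  assumes "j \<in> {1..<n}" "u \<in> carrier (Free {1..n})" "v \<in> carrier (Free {1..n})"
    and "R_map n j (fox_vector n u) = fox_vector n (artin_gen n j u)"
    and "R_map n j (fox_vector n v) = fox_vector n (artin_gen n j v)"
  shows "R_map n j (fox_vector n (u + v)) = fox_vector n (artin_gen n j (u + v))"
  using assms
  by (simp add: fox_vector_add R_map_add R_map_scale fox_vector_closed ab_closed
      artin_gen_add ab_artin_gen)

lemma R_map_fox_vector:
  assumes j: "j \<in> {1..<n}" and "w \<in> carrier (Free {1..n})"
  shows "R_map n j (fox_vector n w) = fox_vector n (artin_gen n j w)"
  using assms(2)
proof (induction rule: Free_induct)
  case zero
  then show ?case using j by (simp add: artin_gen_zero R_map_zero)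
next
  case (gen k v)
  then show ?case using j by (intro R_map_fox_vector_add R_map_fox_vector_gen) auto
next
  case (minus_gen k v)
  have "R_map n j (fox_vector n (- gen k)) = fox_vector n (artin_gen n j (- gen k))"
    using minus_gen(1) j ab_artin_gen[of j n "- gen k"]
    by (simp add: fox_vector_uminus R_map_uminus R_map_scale fox_vector_closed ab_closed
        artin_gen_uminus R_map_fox_vector_gen)
  with minus_gen show ?case using j by (intro R_map_fox_vector_add) auto
qed

section \<open>The induced representations and their intertwining\<close>

lemma phi2B_hom: "phi2B n \<in> hom (Braid n) (Aut (Free_add n))"
  unfolding phi2B_def by (intro braid_group_like.braid_lift_hom braid_group_like_R_map)

lemma phi2B_sigma: "j \<in> {1..<n} \<Longrightarrow> phi2B n (sigma n j) = R_map n j"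
  unfolding phi2B_def by (intro braid_group_like.braid_lift_sigma braid_group_like_R_map)

lemma artin_hom: "artin n \<in> hom (Braid n) (Aut (Free {1..n}))"
  unfolding artin_def by (intro braid_group_like.braid_lift_hom braid_group_like_artin_gen)

lemma artin_sigma: "j \<in> {1..<n} \<Longrightarrow> artin n (sigma n j) = artin_gen n j"
  unfolding artin_def by (intro braid_group_like.braid_lift_sigma braid_group_like_artin_gen)

lemma braid_perm_hom: "braid_perm n \<in> hom (Braid n) (opposite (sym_group n))"
  unfolding braid_perm_def by (intro braid_group_like.braid_lift_hom braid_group_like_transpose)

lemma braid_perm_sigma: "j \<in> {1..<n} \<Longrightarrow> braid_perm n (sigma n j) = transpose j (Suc j)"
  unfolding braid_perm_def
  using braid_group_like.braid_lift_sigma[OF braid_group_like_transpose] by simp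

lemma Aut_hom_apply:
  assumes h: "h \<in> hom (Braid n) (Aut H)" and x: "x \<in> carrier H"
  shows "b \<in> carrier (Braid n) \<Longrightarrow> c \<in> carrier (Braid n) \<Longrightarrow> h (b \<otimes>\<^bsub>Braid n\<^esub> c) x = h c (h b x)"
    and "group H \<Longrightarrow> h \<one>\<^bsub>Braid n\<^esub> x = x"
  using hom_mult[OF h] hom_in_carrier[OF h] hom_one[OF h group_Braid group_Aut] x
  by (simp_all add: mult_Aut_apply one_Aut)

lemma Aut_hom_inv_apply:
  assumes h: "h \<in> hom (Braid n) (Aut H)" and "group H" "x \<in> carrier H" "b \<in> carrier (Braid n)"
  shows "h (inv\<^bsub>Braid n\<^esub> b) (h b x) = x" "h b (h (inv\<^bsub>Braid n\<^esub> b) x) = x"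
proof -
  interpret group "Braid n" by (rule group_Braid)
  show "h (inv\<^bsub>Braid n\<^esub> b) (h b x) = x"
    using Aut_hom_apply(1)[OF h assms(3) assms(4), of "inv\<^bsub>Braid n\<^esub> b"]
      Aut_hom_apply(2)[OF h assms(3,2)] assms(4) by simp
  show "h b (h (inv\<^bsub>Braid n\<^esub> b) x) = x"
    using Aut_hom_apply(1)[OF h assms(3), of "inv\<^bsub>Braid n\<^esub> b" b]
      Aut_hom_apply(2)[OF h assms(3,2)] assms(4) by simp
qed

lemma phi2B_closed:
  "b \<in> carrier (Braid n) \<Longrightarrow> v \<in> carrier (Free_mod n) \<Longrightarrow> phi2B n b v \<in> carrier (Free_mod n)"
  using Aut_closed[of "phi2B n b" "Free_add n" v] hom_in_carrier[OF phi2B_hom] by simp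

lemma artin_closed:
  "b \<in> carrier (Braid n) \<Longrightarrow> w \<in> carrier (Free {1..n}) \<Longrightarrow> artin n b w \<in> carrier (Free {1..n})"
  using Aut_closed[of "artin n b" "Free {1..n}" w] hom_in_carrier[OF artin_hom] by simp

lemma phi2B_apply:
  assumes "v \<in> carrier (Free_mod n)"
  shows "phi2B n \<one>\<^bsub>Braid n\<^esub> v = v"
    and "b \<in> carrier (Braid n) \<Longrightarrow> c \<in> carrier (Braid n) \<Longrightarrow>
      phi2B n (b \<otimes>\<^bsub>Braid n\<^esub> c) v = phi2B n c (phi2B n b v)"
    and "b \<in> carrier (Braid n) \<Longrightarrow> phi2B n (inv\<^bsub>Braid n\<^esub> b) (phi2B n b v) = v"
    and "b \<in> carrier (Braid n) \<Longrightarrow> phi2B n b (phi2B n (inv\<^bsub>Braid n\<^esub> b) v) = v"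
proof -
  have v: "v \<in> carrier (Free_add n)" using assms by simp
  show "phi2B n \<one>\<^bsub>Braid n\<^esub> v = v"
    by (rule Aut_hom_apply(2)[OF phi2B_hom v group_Free_add])
  show "phi2B n (b \<otimes>\<^bsub>Braid n\<^esub> c) v = phi2B n c (phi2B n b v)"
    if "b \<in> carrier (Braid n)" "c \<in> carrier (Braid n)"
    using that by (rule Aut_hom_apply(1)[OF phi2B_hom v])
  show "phi2B n (inv\<^bsub>Braid n\<^esub> b) (phi2B n b v) = v" "phi2B n b (phi2B n (inv\<^bsub>Braid n\<^esub> b) v) = v"
    if "b \<in> carrier (Braid n)"
    using that by (rule Aut_hom_inv_apply[OF phi2B_hom group_Free_add v])+
qed

lemma artin_apply:
  assumes "w \<in> carrier (Free {1..n})"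
  shows "artin n \<one>\<^bsub>Braid n\<^esub> w = w"
    and "b \<in> carrier (Braid n) \<Longrightarrow> c \<in> carrier (Braid n) \<Longrightarrow>
      artin n (b \<otimes>\<^bsub>Braid n\<^esub> c) w = artin n c (artin n b w)"
    and "b \<in> carrier (Braid n) \<Longrightarrow> artin n b (artin n (inv\<^bsub>Braid n\<^esub> b) w) = w"
  using Aut_hom_apply[OF artin_hom assms] Aut_hom_inv_apply(2)[OF artin_hom group_Free assms]
  by auto

text \<open>The split-off generator acts first and the rest of the braid acts on its image, so the
  induction runs over all \<open>w\<close> simultaneously.\<close>

lemma phi2B_fox_vector:
  assumes "b \<in> carrier (Braid n)" "w \<in> carrier (Free {1..n})"
  shows "phi2B n b (fox_vector n w) = fox_vector n (artin n b w)"
  using assms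
proof (induction arbitrary: w rule: Braid_induct)
  case one
  then show ?case using fox_vector_closed[OF one] by (simp add: phi2B_apply artin_apply)
next
  case (sigma i b)
  then show ?case
    using fox_vector_closed[OF sigma.prems] artin_gen_closed[OF sigma(1) sigma.prems]
    by (simp add: phi2B_apply artin_apply phi2B_sigma artin_sigma R_map_fox_vector)
next
  case (inv_sigma i b)
  interpret group "Braid n" by (rule group_Braid)
  let ?i = "inv\<^bsub>Braid n\<^esub> (sigma n i)"
  have i: "sigma n i \<in> carrier (Braid n)" "?i \<in> carrier (Braid n)" using inv_sigma(1) by auto
  \<comment> \<open>The inverse case comes from the positive one: \<open>w\<close> is the image of
    \<open>v\<close> under the generator, so the intertwining can be used at \<open>v\<close> and
    the generator then cancelled.\<close>
  define v where "v = artin n ?i w"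
  have v: "v \<in> carrier (Free {1..n})" unfolding v_def by (rule artin_closed[OF i(2) inv_sigma.prems])
  have w: "w = artin_gen n i v"
    using artin_apply(3)[OF inv_sigma.prems i(1)] artin_sigma[OF inv_sigma(1)] by (simp add: v_def)
  have "phi2B n ?i (fox_vector n w) = phi2B n ?i (phi2B n (sigma n i) (fox_vector n v))"
    by (simp add: w R_map_fox_vector[OF inv_sigma(1) v] phi2B_sigma[OF inv_sigma(1)])
  also have "\<dots> = fox_vector n v"
    by (rule phi2B_apply(3)[OF fox_vector_closed[OF v] i(1)])
  finally have "phi2B n ?i (fox_vector n w) = fox_vector n (artin n ?i w)" unfolding v_def .
  then show ?case
    using phi2B_apply(2)[OF fox_vector_closed[OF inv_sigma.prems] i(2) inv_sigma(2)]
      artin_apply(2)[OF inv_sigma.prems i(2) inv_sigma(2)] inv_sigma.IH[OF v]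
    by (simp add: v_def)
qed

section \<open>Semilinearity of the action of a braid\<close>

lemma braid_perm_mult:
  "b \<in> carrier (Braid n) \<Longrightarrow> c \<in> carrier (Braid n) \<Longrightarrow>
    braid_perm n (b \<otimes>\<^bsub>Braid n\<^esub> c) = braid_perm n c \<circ> braid_perm n b"
  using hom_mult[OF braid_perm_hom] by (simp add: opposite_def sym_group_def)

lemma braid_perm_one: "braid_perm n \<one>\<^bsub>Braid n\<^esub> = id"
  using hom_one[OF braid_perm_hom group_Braid group_opposite[OF sym_group_is_group]]
  by (simp add: opposite_def sym_group_def)

lemma braid_perm_permutes: "b \<in> carrier (Braid n) \<Longrightarrow> braid_perm n b permutes {1..n}"
  using hom_in_carrier[OF braid_perm_hom] by (simp add: opposite_def sym_group_def)

lemma braid_perm_inv_sigma: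
  assumes i: "i \<in> {1..<n}"
  shows "braid_perm n (inv\<^bsub>Braid n\<^esub> (sigma n i)) = transpose i (Suc i)"
proof -
  interpret group "Braid n" by (rule group_Braid)
  have "transpose i (Suc i) \<circ> braid_perm n (inv\<^bsub>Braid n\<^esub> (sigma n i)) = id"
    using braid_perm_mult[of "inv\<^bsub>Braid n\<^esub> (sigma n i)" n "sigma n i"] i
    by (simp add: braid_perm_sigma braid_perm_one)
  then have "transpose i (Suc i) \<circ> (transpose i (Suc i) \<circ> braid_perm n (inv\<^bsub>Braid n\<^esub> (sigma n i))) =
      transpose i (Suc i)" by simp
  then show ?thesis by (simp flip: o_assoc add: o_assoc)
qed

text \<open>The twist of the first factor is applied first. This matches
  \<open>braid_perm_mult\<close>, which puts the permutation of the left factor innermost, together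
  with \<open>perm_vars_comp\<close>.\<close>

lemma phi2B_scale:
  assumes "b \<in> carrier (Braid n)" "\<alpha> \<in> carrier (Laurent n)" "v \<in> carrier (Free_mod n)"
  shows "phi2B n b (scale \<alpha> v) = scale (perm_vars (braid_perm n b) \<alpha>) (phi2B n b v)"
  using assms
proof (induction arbitrary: \<alpha> v rule: Braid_induct)
  case one
  then show ?case using scale_in_Free_mod[OF one] by (simp add: phi2B_apply braid_perm_one)
next
  case (sigma i b)
  have *: "perm_vars (braid_perm n b) (swap_vars i \<alpha>) = perm_vars (braid_perm n (sigma n i \<otimes>\<^bsub>Braid n\<^esub> b)) \<alpha>"
    using sigma(1,2) permutes_bij[OF braid_perm_permutes[OF sigma(2)]]
    by (simp add: braid_perm_mult braid_perm_sigma swap_vars_eq perm_vars_comp)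
  show ?case
    unfolding *[symmetric]
    using sigma scale_in_Free_mod[OF sigma.prems]
    by (simp add: phi2B_apply phi2B_sigma R_map_scale swap_vars_in_Laurent R_map_closed)
next
  case (inv_sigma i b)
  interpret group "Braid n" by (rule group_Braid)
  let ?i = "inv\<^bsub>Braid n\<^esub> (sigma n i)"
  have i: "sigma n i \<in> carrier (Braid n)" "?i \<in> carrier (Braid n)" using inv_sigma(1) by auto
  define u where "u = phi2B n ?i v"
  have u: "u \<in> carrier (Free_mod n)" unfolding u_def by (rule phi2B_closed[OF i(2) inv_sigma.prems(2)])
  have s: "swap_vars i \<alpha> \<in> carrier (Laurent n)"
    by (rule swap_vars_in_Laurent[OF inv_sigma(1) inv_sigma.prems(1)])
  have v: "v = R_map n i u"
    using phi2B_apply(4)[OF inv_sigma.prems(2) i(1)] phi2B_sigma[OF inv_sigma(1)] by (simp add: u_def)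
  \<comment> \<open>Since \<open>swap_vars i\<close> is an involution, \<open>\<alpha>\<close> can
    be pulled inside \<open>R_map n i\<close> as its swap; the generator then cancels against its
    inverse.\<close>
  have "phi2B n ?i (scale \<alpha> v) = phi2B n ?i (phi2B n (sigma n i) (scale (swap_vars i \<alpha>) u))"
    by (simp add: v R_map_scale[OF s u inv_sigma(1)] phi2B_sigma[OF inv_sigma(1)])
  also have "\<dots> = scale (swap_vars i \<alpha>) u"
    by (rule phi2B_apply(3)[OF scale_in_Free_mod[OF s u] i(1)])
  finally have "phi2B n ?i (scale \<alpha> v) = scale (swap_vars i \<alpha>) u" .
  moreover have "perm_vars (braid_perm n b) (swap_vars i \<alpha>) =
      perm_vars (braid_perm n (?i \<otimes>\<^bsub>Braid n\<^esub> b)) \<alpha>"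
    using inv_sigma(1,2) i permutes_bij[OF braid_perm_permutes[OF inv_sigma(2)]]
    by (simp add: braid_perm_mult braid_perm_inv_sigma swap_vars_eq perm_vars_comp)
  ultimately show ?case
    using phi2B_apply(2)[OF scale_in_Free_mod[OF inv_sigma.prems] i(2) inv_sigma(2)]
      phi2B_apply(2)[OF inv_sigma.prems(2) i(2) inv_sigma(2)] inv_sigma.IH[OF s u]
    by (simp add: u_def)
qed

section \<open>The Gassner representation\<close>

lemma carrier_Pure_braid:
  "b \<in> carrier (Pure_braid n) \<longleftrightarrow> b \<in> carrier (Braid n) \<and> braid_perm n b = id"
  by (simp add: Pure_braid_def kernel_def opposite_def sym_group_def)

lemma mult_Pure_braid: "b \<otimes>\<^bsub>Pure_braid n\<^esub> c = b \<otimes>\<^bsub>Braid n\<^esub> c"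
  by (simp add: Pure_braid_def)

lemma pure_gen_eq: "pure_gen n i j = braid_group_like.pgen (Braid n) (sigma n) i j"
  unfolding pure_gen_def pure_conj_def
  by (simp only: braid_group_like.pgen_def[OF braid_group_like_Braid]
      braid_group_like.pconj_def[OF braid_group_like_Braid])

text \<open>One inclusion is \<open>kernel_pi_subset_pure\<close> on all \<open>n\<close> strands,
  which is applicable because the elements \<open>sigma n i\<close> generate the braid group; the
  other is \<open>pi_pure\<close>.\<close>

lemma Pure_braid_eq_generate:
  "carrier (Pure_braid n) =
    generate (Braid n) {pure_gen n i j | i j. 1 \<le> i \<and> i < j \<and> j \<le> n}" (is "_ = generate _ ?S")
proof -
  interpret braid_group_like "Braid n" "sigma n" n by (rule braid_group_like_Braid)
  have S: "?S = pgens" by (simp add: pgens_def pure_gen_eq)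
  have perm: "braid_perm n (sigma n i) = transpose i (Suc i)" if "i \<in> {1..<n}" for i
    using that by (rule braid_perm_sigma)
  have gen: "b \<in> generate (Braid n) (sigma n ` {1..<n})" if "b \<in> carrier (Braid n)" for b
    using that
    by (induction rule: Braid_induct)
      (auto intro: generate.one generate.eng[OF generate.incl] generate.eng[OF generate.inv])
  show ?thesis
  proof
    show "carrier (Pure_braid n) \<subseteq> generate (Braid n) ?S"
      unfolding S carrier_Pure_braid subset_iff
      using kernel_pi_subset_pure[OF braid_perm_hom perm order_refl gen] by blast
    show "generate (Braid n) ?S \<subseteq> carrier (Pure_braid n)"
      unfolding S carrier_Pure_braid subset_iff
      using pi_pure[OF braid_perm_hom perm] subgroup.subset[OF subgroup_pure] by blast
  qed
qed

section \<open>Linear automorphisms; existence and uniqueness\<close>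

lemma carrier_GL:
  "f \<in> carrier (GL n) \<longleftrightarrow> f \<in> carrier (Aut (Free_add n)) \<and>
    (\<forall>\<alpha> \<in> carrier (Laurent n). \<forall>v \<in> carrier (Free_mod n). f (scale \<alpha> v) = scale \<alpha> (f v))"
  by (simp add: GL_def Free_mod_def)

lemma mult_GL: "f \<otimes>\<^bsub>GL n\<^esub> g = f \<otimes>\<^bsub>Aut (Free_add n)\<^esub> g"
  by (simp add: GL_def)

lemma GL_eqI:
  assumes f: "f \<in> carrier (GL n)" and g: "g \<in> carrier (GL n)"
    and eq: "\<And>k. k \<in> {1..n} \<Longrightarrow> f (basis k) = g (basis k)"
  shows "f = g"
proof (rule Aut_eqI)
  show "f \<in> carrier (Aut (Free_add n))" "g \<in> carrier (Aut (Free_add n))"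
    using f g by (auto simp: carrier_GL)
  fix v assume "v \<in> carrier (Free_add n)"
  then have v: "v \<in> carrier (Free_mod n)" by simp
  let ?t = "\<lambda>k. scale (Poly_Mapping.lookup v k) (basis k)"
  have t: "?t k \<in> carrier (Free_mod n)" if "k \<in> {1..n}" for k
    using that v by (intro scale_in_Free_mod single_in_Free_mod one_in_Laurent) (simp add: carrier_Free_mod)
  have sum: "h (\<Sum>k\<in>A. ?t k) = (\<Sum>k\<in>A. scale (Poly_Mapping.lookup v k) (h (basis k)))"
    if h: "h \<in> carrier (GL n)" and "A \<subseteq> {1..n}" for h A
  proof -
    have add: "h (x + y) = h x + h y" if "x \<in> carrier (Free_mod n)" "y \<in> carrier (Free_mod n)" for x y
      using h that by (auto simp: carrier_GL carrier_Aut hom_def)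
    have zero: "h 0 = 0" using add[of 0 0] by simp
    have "finite A" using that(2) finite_subset by blast
    then show ?thesis using that(2)
    proof (induction A)
      case (insert k A)
      have "h (?t k + (\<Sum>k\<in>A. ?t k)) = h (?t k) + h (\<Sum>k\<in>A. ?t k)"
        using insert.prems by (intro add sum_in_Free_mod t) auto
      moreover have "h (?t k) = scale (Poly_Mapping.lookup v k) (h (basis k))"
        using h v single_in_Free_mod[of k n 1] insert.prems one_in_Laurent unfolding carrier_GL carrier_Free_mod[of v]
        by blast
      ultimately show ?case using insert by (simp del: map_single)
    qed (simp add: zero)
  qed
  have "v = (\<Sum>k = 1..n. ?t k)"
    by (rule poly_mapping_eqI) (use v in \<open>auto simp: lookup_sum lookup_single when_def carrier_Free_mod\<close>)
  then show "f v = g v"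
    using sum[OF f order_refl] sum[OF g order_refl] eq by (metis (no_types, lifting) sum.cong)
qed

lemma phi2B_in_GL: "p \<in> carrier (Pure_braid n) \<Longrightarrow> phi2B n p \<in> carrier (GL n)"
  using hom_in_carrier[OF phi2B_hom] by (auto simp: carrier_GL carrier_Pure_braid phi2B_scale)

lemma phi2B_hom_GL: "phi2B n \<in> hom (Pure_braid n) (GL n)"
  using phi2B_in_GL hom_mult[OF phi2B_hom]
  by (intro homI) (auto simp: mult_GL mult_Pure_braid carrier_Pure_braid)

text \<open>\<open>basis r\<close> is the Fox vector of \<open>gen r\<close>, so the intertwining
  yields the whole row, for every braid and in particular for the pure generators.\<close>

lemma phi2B_basis:
  assumes "b \<in> carrier (Braid n)" "r \<in> {1..n}"
  shows "phi2B n b (basis r) = (\<Sum>s = 1..n. scale (gassner_matrix n b r s) (basis s))"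
  using phi2B_fox_vector[OF assms(1), of "gen r"] assms(2)
  by (simp add: fox_vector_gen gassner_matrix_def fox_vector_def[of n "artin n b (gen r)"])

lemma pure_gen_in_Pure_braid:
  "1 \<le> i \<Longrightarrow> i < j \<Longrightarrow> j \<le> n \<Longrightarrow> pure_gen n i j \<in> carrier (Pure_braid n)"
  unfolding Pure_braid_eq_generate by (rule generate.incl) blast

lemma is_gassner_phi2B: "is_gassner n (phi2B n)"
  unfolding is_gassner_def
  using phi2B_hom_GL phi2B_basis pure_gen_in_Pure_braid by (auto simp: carrier_Pure_braid)

text \<open>The prescribed matrices fix both maps on each pure generator by linearity, and these
  generate the pure braid group.\<close>

lemma is_gassner_unique:
  assumes \<psi>: "is_gassner n \<psi>" and \<chi>: "is_gassner n \<chi>" and p: "p \<in> carrier (Pure_braid n)"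
  shows "\<psi> p = \<chi> p"
proof -
  interpret B: group "Braid n" by (rule group_Braid)
  interpret A: group "Aut (Free_add n)" by (intro group_Aut group_Free_add)
  have sub: "subgroup (carrier (Pure_braid n)) (Braid n)"
    unfolding Pure_braid_eq_generate
    using pure_gen_in_Pure_braid
    by (intro B.generate_is_subgroup) (auto simp: carrier_Pure_braid)
  have Pure: "Pure_braid n = (Braid n)\<lparr>carrier := carrier (Pure_braid n)\<rparr>"
    by (simp add: Pure_braid_def)
  have hom: "group_hom (Pure_braid n) (Aut (Free_add n)) \<theta>" if "is_gassner n \<theta>" for \<theta>
  proof (intro group_hom.intro group_hom_axioms.intro A.is_group)
    show "group (Pure_braid n)"
      using subgroup.subgroup_is_group[OF sub B.is_group] Pure by simp
    show "\<theta> \<in> hom (Pure_braid n) (Aut (Free_add n))"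
      using that by (auto simp: is_gassner_def hom_def carrier_GL mult_GL)
  qed
  interpret \<psi>: group_hom "Pure_braid n" "Aut (Free_add n)" \<psi> by (rule hom[OF \<psi>])
  interpret \<chi>: group_hom "Pure_braid n" "Aut (Free_add n)" \<chi> by (rule hom[OF \<chi>])
  have gen: "\<psi> (pure_gen n i j) = \<chi> (pure_gen n i j)" if "1 \<le> i" "i < j" "j \<le> n" for i j
    using that \<psi> \<chi> pure_gen_in_Pure_braid[OF that]
    by (intro GL_eqI[of _ n]) (auto simp: is_gassner_def hom_def)
  \<comment> \<open>The induction below is over \<open>generate\<close> in \<open>Braid n\<close>,
    while the homomorphisms live on \<open>Pure_braid n\<close>; inverses and units of the two
    groups have to be identified.\<close>
  have inv_eq: "inv\<^bsub>Braid n\<^esub> a = inv\<^bsub>Pure_braid n\<^esub> a" if "a \<in> carrier (Pure_braid n)" for a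
    using B.m_inv_consistent[OF sub that] Pure by simp
  have one_eq: "\<one>\<^bsub>Braid n\<^esub> = \<one>\<^bsub>Pure_braid n\<^esub>" by (simp add: Pure_braid_def)
  let ?S = "{pure_gen n i j | i j. 1 \<le> i \<and> i < j \<and> j \<le> n}"
  from p have "p \<in> generate (Braid n) ?S" by (simp add: Pure_braid_eq_generate)
  then show ?thesis
  proof (induction rule: generate.induct)
    case one
    show ?case by (simp add: one_eq)
  next
    case (incl h)
    then show ?case using gen by auto
  next
    case (inv h)
    then have "h \<in> carrier (Pure_braid n)" "\<psi> h = \<chi> h" using gen pure_gen_in_Pure_braid by auto
    then show ?case by (simp add: inv_eq)
  next
    case (eng h1 h2)
    then have "h1 \<in> carrier (Pure_braid n)" "h2 \<in> carrier (Pure_braid n)"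
      by (simp_all add: Pure_braid_eq_generate)
    with eng show ?case
      using \<psi>.hom_mult[of h1 h2] \<chi>.hom_mult[of h1 h2] by (simp add: mult_Pure_braid)
  qed
qed

theorem theorem4:
  fixes n :: nat
  assumes "n \<ge> 2"
  shows "(\<forall>j \<in> {1..<n}. R_map n j \<in> carrier (Aut (Free_add n)))
    \<and> phi2B n \<in> hom (Braid n) (Aut (Free_add n))
    \<and> (\<forall>j \<in> {1..<n}. phi2B n (sigma n j) = R_map n j)
    \<and> phi2B n \<in> hom (Pure_braid n) (GL n)
    \<and> is_gassner n (phi2B n)
    \<and> (\<forall>\<phi>\<^sub>G. is_gassner n \<phi>\<^sub>G \<longrightarrow>
          (\<forall>p \<in> carrier (Pure_braid n). phi2B n p = \<phi>\<^sub>G p))"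
proof (intro conjI ballI allI impI)
  show "R_map n j \<in> carrier (Aut (Free_add n))" if "j \<in> {1..<n}" for j
    using that by (rule R_map_in_Aut)
  show "phi2B n \<in> hom (Braid n) (Aut (Free_add n))" by (rule phi2B_hom)
  show "phi2B n (sigma n j) = R_map n j" if "j \<in> {1..<n}" for j
    using that by (rule phi2B_sigma)
  show "phi2B n \<in> hom (Pure_braid n) (GL n)" by (rule phi2B_hom_GL)
  show "is_gassner n (phi2B n)" by (rule is_gassner_phi2B)
  show "phi2B n p = \<phi>\<^sub>G p" if "is_gassner n \<phi>\<^sub>G" "p \<in> carrier (Pure_braid n)" for \<phi>\<^sub>G p
    using is_gassner_phi2B that by (rule is_gassner_unique)
qed

end
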